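(* There exists a geodesic metric space $X$ biLipschitz homeomorphic to $\mathbb{R}^2$ which satisfies $$\liminf_{r\to\infty}\frac{\delta^{\operatorname{Lip}}_X(r)}{r^2}>\frac{1}{4\pi}$$ and whose unique asymptotic cone is (isometric to) the Euclidean plane, i.e. every asymptotic cone of $X$ is isometric to Euclidean $\mathbb{R}^2$.
   Context: $\overline{D}$ is the closed unit disc in $\mathbb{R}^2$, $D$ the open unit disc, $S^1$ its boundary. For a Lipschitz map $v\colon \overline{D}\to X$ into a complete metric space, $\operatorname{Area}(v)=\int_D {\mathbf J}(\operatorname{md} v_z)\,dz$ is the parametrized Hausdorff area, where $\operatorname{md} v_z$ is the metric derivative of $v$ at $z$ (the seminorm $s$ with $\lim_{z'\to z}\frac{d(v(z'),v(z))-s(z'-z)}{|z'-z|}=0$, existing for a.e. $z$), and ${\mathbf J}(s)$ is the Hausdorff $2$-measure in $(\mathbb{R}^2,s)$ of the Euclidean unit square if $s$ is a norm and $0$ otherwise. For a Lipschitz curve $c\colon S^1\to X$, $\operatorname{FillArea}^{\operatorname{Lip}}(c)=\inf\{\operatorname{Area}(v): v\colon\overline{D}\to X \text{ Lipschitz}, v|_{S^1}=c\}$, and $\delta^{\operatorname{Lip}}_X(r)=\sup\{\operatorname{FillArea}^{\operatorname{Lip}}(c): c \text{ Lipschitz}, \ell(c)\le r\}$. An asymptotic cone of $(X,d)$ is the ultralimit, with respect to a non-principal ultrafilter $\omega$ on $\mathbb{N}$, of $(X,t_nd,p_n)$ for basepoints $p_n\in X$ and positive reals $t_n\to 0$. 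*)

theory Defs
  imports "HOL-Analysis.Analysis"
begin

definition is_metric :: "('a \<Rightarrow> 'a \<Rightarrow> real) \<Rightarrow> bool" where
  "is_metric d \<longleftrightarrow> (\<forall>x y. d x y = 0 \<longleftrightarrow> x = y) \<and> (\<forall>x y. d x y = d y x)
     \<and> (\<forall>x y z. d x z \<le> d x y + d y z)"

definition complete_metric :: "('a \<Rightarrow> 'a \<Rightarrow> real) \<Rightarrow> bool" where
  "complete_metric d \<longleftrightarrow> (\<forall>x :: nat \<Rightarrow> 'a.
     (\<forall>e>0. \<exists>N. \<forall>m\<ge>N. \<forall>n\<ge>N. d (x m) (x n) < e) \<longrightarrow>
     (\<exists>l. ((\<lambda>n. d (x n) l) \<longlongrightarrow> 0) sequentially))"

definition geodesic_metric :: "('a \<Rightarrow> 'a \<Rightarrow> real) \<Rightarrow> bool" where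
  "geodesic_metric d \<longleftrightarrow> (\<forall>x y. \<exists>\<gamma> :: real \<Rightarrow> 'a. \<gamma> 0 = x \<and> \<gamma> (d x y) = y \<and>
     (\<forall>s\<in>{0..d x y}. \<forall>t\<in>{0..d x y}. d (\<gamma> s) (\<gamma> t) = \<bar>s - t\<bar>))"

definition bilipschitz_to_R2 :: "('a \<Rightarrow> 'a \<Rightarrow> real) \<Rightarrow> bool" where
  "bilipschitz_to_R2 d \<longleftrightarrow> (\<exists>(f :: real^2 \<Rightarrow> 'a) (L::real). L > 0 \<and> bij f \<and>
     (\<forall>x y. dist x y \<le> L * d (f x) (f y) \<and> d (f x) (f y) \<le> L * dist x y))"

definition seminorm2 :: "(real^2 \<Rightarrow> real) \<Rightarrow> bool" where
  "seminorm2 s \<longleftrightarrow> (\<forall>x y. s (x + y) \<le> s x + s y) \<and> (\<forall>c x. s (c *\<^sub>R x) = \<bar>c\<bar> * s x)"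

definition norm2 :: "(real^2 \<Rightarrow> real) \<Rightarrow> bool" where
  "norm2 s \<longleftrightarrow> seminorm2 s \<and> (\<forall>x. s x = 0 \<longrightarrow> x = 0)"

definition ddiam :: "('a \<Rightarrow> 'a \<Rightarrow> real) \<Rightarrow> 'a set \<Rightarrow> ennreal" where
  "ddiam dd S = (SUP x\<in>S. SUP y\<in>S. ennreal (dd x y))"

text \<open>Hausdorff 2-measure (normalised by \<open>\<omega>\<^sub>2/4 = pi/4\<close>) w.r.t. a distance function.\<close>
definition hausdorff2 :: "('a \<Rightarrow> 'a \<Rightarrow> real) \<Rightarrow> 'a set \<Rightarrow> ennreal" where
  "hausdorff2 dd A = (SUP \<delta>\<in>{0::real<..}.
     INF C \<in> {C :: nat \<Rightarrow> 'a set. A \<subseteq> (\<Union>i. C i) \<and> (\<forall>i. ddiam dd (C i) < ennreal \<delta>)}.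
       (\<Sum>i. ennreal (pi / 4) * (ddiam dd (C i))\<^sup>2))"

definition unit_square :: "(real^2) set" where
  "unit_square = {x. \<forall>i. 0 \<le> x $ i \<and> x $ i \<le> 1}"

definition jacobian :: "(real^2 \<Rightarrow> real) \<Rightarrow> ennreal" where
  "jacobian s = (if norm2 s then hausdorff2 (\<lambda>x y. s (x - y)) unit_square else 0)"

definition is_metric_derivative ::
  "('a \<Rightarrow> 'a \<Rightarrow> real) \<Rightarrow> (real^2 \<Rightarrow> 'a) \<Rightarrow> real^2 \<Rightarrow> (real^2 \<Rightarrow> real) \<Rightarrow> bool" where
  "is_metric_derivative d v z s \<longleftrightarrow> seminorm2 s \<and>
     ((\<lambda>z'. (d (v z') (v z) - s (z' - z)) / norm (z' - z)) \<longlongrightarrow> 0) (at z)"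

definition md :: "('a \<Rightarrow> 'a \<Rightarrow> real) \<Rightarrow> (real^2 \<Rightarrow> 'a) \<Rightarrow> real^2 \<Rightarrow> (real^2 \<Rightarrow> real)" where
  "md d v z = (THE s. is_metric_derivative d v z s)"

definition d_lipschitz_on :: "('a \<Rightarrow> 'a \<Rightarrow> real) \<Rightarrow> (real^2) set \<Rightarrow> (real^2 \<Rightarrow> 'a) \<Rightarrow> bool" where
  "d_lipschitz_on d A v \<longleftrightarrow> (\<exists>L. \<forall>z\<in>A. \<forall>z'\<in>A. d (v z) (v z') \<le> L * dist z z')"

definition area :: "('a \<Rightarrow> 'a \<Rightarrow> real) \<Rightarrow> (real^2 \<Rightarrow> 'a) \<Rightarrow> ennreal" where
  "area d v = (\<integral>\<^sup>+ z \<in> ball 0 1. jacobian (md d v z) \<partial>lebesgue)"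

definition circ :: "real \<Rightarrow> real^2" where
  "circ \<theta> = (\<chi> i. if i = 1 then cos \<theta> else sin \<theta>)"

definition curve_length :: "('a \<Rightarrow> 'a \<Rightarrow> real) \<Rightarrow> (real \<Rightarrow> 'a) \<Rightarrow> real \<Rightarrow> real \<Rightarrow> ennreal" where
  "curve_length d \<gamma> a b = (SUP (k, t) \<in> {(k, t :: nat \<Rightarrow> real). t 0 = a \<and> t k = b \<and>
       (\<forall>i<k. t i \<le> t (Suc i))}. \<Sum>i<k. ennreal (d (\<gamma> (t i)) (\<gamma> (t (Suc i)))))"

definition loop_length :: "('a \<Rightarrow> 'a \<Rightarrow> real) \<Rightarrow> (real^2 \<Rightarrow> 'a) \<Rightarrow> ennreal" where
  "loop_length d c = curve_length d (\<lambda>\<theta>. c (circ \<theta>)) 0 (2 * pi)"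

definition fill_area_lip :: "('a \<Rightarrow> 'a \<Rightarrow> real) \<Rightarrow> (real^2 \<Rightarrow> 'a) \<Rightarrow> ennreal" where
  "fill_area_lip d c = (INF v \<in> {v. d_lipschitz_on d (cball 0 1) v \<and> (\<forall>z\<in>sphere 0 1. v z = c z)}.
      area d v)"

definition dehn_lip :: "('a \<Rightarrow> 'a \<Rightarrow> real) \<Rightarrow> real \<Rightarrow> ennreal" where
  "dehn_lip d r = (SUP c \<in> {c. d_lipschitz_on d (sphere 0 1) c \<and> loop_length d c \<le> ennreal r}.
      fill_area_lip d c)"

definition nonprincipal_ultrafilter :: "nat filter \<Rightarrow> bool" where
  "nonprincipal_ultrafilter \<omega> \<longleftrightarrow> \<omega> \<noteq> bot \<and>
     (\<forall>P. eventually P \<omega> \<or> eventually (\<lambda>n. \<not> P n) \<omega>) \<and> \<omega> \<le> cofinite"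

text \<open>Every asymptotic cone (ultralimit of \<open>(X, t\<^sub>n d, p\<^sub>n)\<close>) is isometric to Euclidean
  \<open>\<real>\<^sup>2\<close>: there is a map from the admissible sequences onto \<open>\<real>\<^sup>2\<close> turning the ultralimit
  pseudo-distance into the Euclidean distance (equivalently, a surjective isometry from the
  metric quotient, i.e. the cone).\<close>
definition all_asymptotic_cones_euclidean_plane :: "('a \<Rightarrow> 'a \<Rightarrow> real) \<Rightarrow> bool" where
  "all_asymptotic_cones_euclidean_plane d \<longleftrightarrow>
    (\<forall>(\<omega> :: nat filter) (p :: nat \<Rightarrow> 'a) (t :: nat \<Rightarrow> real).
       nonprincipal_ultrafilter \<omega> \<and> (\<forall>n. 0 < t n) \<and> t \<longlonglongrightarrow> 0 \<longrightarrow>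
       (\<exists>f :: (nat \<Rightarrow> 'a) \<Rightarrow> real^2.
          let B = {x :: nat \<Rightarrow> 'a. \<exists>C. \<forall>n. t n * d (x n) (p n) \<le> C} in
          f ` B = UNIV \<and>
          (\<forall>x\<in>B. \<forall>y\<in>B. ((\<lambda>n. t n * d (x n) (y n)) \<longlongrightarrow> dist (f x) (f y)) \<omega>)))"

end

theory Submission
  imports Defs "HOL-Complex_Analysis.Great_Picard"
begin

text \<open>Fix a countable, locally finite family of straight lines in the plane whose directions are
  dense and such that the lines of each given direction are equally spaced. Travelling along one of
  these lines costs the Euclidean length, any other segment costs \<open>\<Lambda>\<close> times its length, and the
  metric is the infimum of the costs of polygonal chains. A segment can be replaced, up to a small
  multiplicative and a bounded additive error, by a trip along a line of nearly the same direction,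
  so every asymptotic cone is Euclidean. The lines form a null set and away from them the metric is
  locally \<open>\<Lambda>\<close> times the Euclidean one, so areas are multiplied by \<open>\<Lambda>\<^sup>2\<close>. Yet large squares with
  sides on lines keep their Euclidean perimeter, so for large \<open>\<Lambda>\<close> they violate the Euclidean
  isoperimetric inequality; the crude choice \<open>\<Lambda> = 1000\<close> absorbs all losses of constants.

  A Lipschitz filling of such a square is differentiable almost everywhere (Rademacher), where its
  metric derivative is \<open>\<Lambda>\<close> times the norm of its differential, and it covers the square because the
  disc does not retract onto its boundary.\<close>

section \<open>Differentiability of Lipschitz functions of one variable\<close>

text \<open>A filling may send a set of positive area into the lines, where distances are not
  locally \<Lambda> times Euclidean. Such points are simply discarded: their image lies in the null
  set \<open>lines\<close>, so the remaining points still cover the square up to measure zero, and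
  covering is all that the area estimate uses. Dense directions and local finiteness pull against
  each other: with bounded spacing, every large disc would meet lines of all directions. Hence the
  spacing 2k+1 grows with the index of the direction. The additive error of travelling in direction
  k then grows as well, but by compactness of the circle each accuracy uses only finitely many
  directions. Constants: a square of half-side a with sides on lines has perimeter 8a and area 4
  \<Lambda>^2 a^2 in the metric. The proof gets 160a, since it measures the loop by a crude
  Lipschitz constant, and \<Lambda>^2 a^2, since it encloses sets of diameter r in balls of radius
  r. The discrete choice of a costs another factor 2 in length. What remains is \<Lambda>^2/320^2 >
  9, far above 1/(4 pi) < 1/12.\<close>

lemma Vitali_fine_cover:
  fixes S U :: "'a::euclidean_space set"
  assumes "open U" "S \<subseteq> U"
    and fine: "\<And>x d. x \<in> S \<Longrightarrow> d > 0 \<Longrightarrow> \<exists>c r. 0 < r \<and> r < d \<and> x \<in> cball c r \<and> P c r"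
  obtains C :: "('a \<times> real) set" where "countable C"
    "\<And>c r. (c, r) \<in> C \<Longrightarrow> 0 < r \<and> cball c r \<subseteq> U \<and> P c r"
    "disjoint_family_on (\<lambda>i. cball (fst i) (snd i)) C"
    "negligible (S - (\<Union>i\<in>C. cball (fst i) (snd i)))"
proof -
  define K where "K = {(c, r). 0 < r \<and> cball c r \<subseteq> U \<and> P c r}"
  have cover: "\<exists>i. i \<in> K \<and> x \<in> cball (fst i) (snd i) \<and> snd i < d" if "x \<in> S" "0 < d" for x d
  proof -
    obtain e where e: "e > 0" "cball x e \<subseteq> U"
      using \<open>open U\<close> \<open>S \<subseteq> U\<close> \<open>x \<in> S\<close> open_contains_cball[of U] by (meson subsetD)
    \<comment> \<open>The point \<open>x\<close> may lie off centre, which admits secant intervals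
      having \<open>x\<close> as an endpoint. The ball then reaches up to 2r away from
      \<open>x\<close>, hence the bound \<open>e/2\<close>.\<close>
    obtain c r where cr: "0 < r" "r < min d (e/2)" "x \<in> cball c r" "P c r"
      using fine[OF \<open>x \<in> S\<close>, of "min d (e/2)"] \<open>0 < d\<close> \<open>0 < e\<close> by (metis half_gt_zero min_less_iff_conj)
    have "cball c r \<subseteq> cball x e"
    proof
      fix y assume "y \<in> cball c r"
      then have "dist x y \<le> r + r"
        using cr dist_triangle[of x y c] by (simp add: dist_commute)
      then show "y \<in> cball x e" using cr by simp
    qed
    then show ?thesis using cr e by (intro exI[of _ "(c, r)"]) (auto simp: K_def)
  qed
  obtain C where C: "countable C" "C \<subseteq> K"
     "pairwise (\<lambda>i j. disjnt (cball (fst i) (snd i)) (cball (fst j) (snd j))) C"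
     "negligible (S - (\<Union>i \<in> C. cball (fst i) (snd i)))"
  proof (rule Vitali_covering_theorem_cballs[of K snd S fst])
    show "0 < snd i" if "i \<in> K" for i using that by (auto simp: K_def)
  qed (use cover in blast)+
  show ?thesis
  proof (rule that[of C])
    show "disjoint_family_on (\<lambda>i. cball (fst i) (snd i)) C"
      using C(3) by (auto simp: disjoint_family_on_def pairwise_def disjnt_def)
    show "0 < r \<and> cball c r \<subseteq> U \<and> P c r" if "(c, r) \<in> C" for c r
      using C(2) that by (auto simp: K_def)
  qed (fact C)+
qed

lemma sets_lebesgue_cball [simp]: "cball c r \<in> sets lebesgue"
  for c :: "'a::euclidean_space"
  by simp

lemma negligible_Lipschitz_image:
  fixes f :: "'a::euclidean_space \<Rightarrow> 'b::euclidean_space"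
  assumes "DIM('a) \<le> DIM('b)" "negligible S" and L: "\<And>x y. dist (f x) (f y) \<le> L * dist x y"
  shows "negligible (f ` S)"
proof (rule negligible_locally_Lipschitz_image[OF assms(1,2)])
  fix x
  show "\<exists>T B. open T \<and> x \<in> T \<and> (\<forall>y \<in> S \<inter> T. norm (f y - f x) \<le> B * norm (y - x))"
    by (rule exI[of _ UNIV], rule exI[of _ L]) (use L in \<open>auto simp: dist_norm\<close>)
qed

text \<open>Disjoint intervals of secant slope at most \<open>p\<close>, inside an open set barely
  larger than \<open>S\<close>, cover \<open>S\<close> up to a null set. By monotonicity their
  images are disjoint intervals, at most \<open>p\<close> times as long. The Lipschitz bound
  \<open>M\<close> keeps the image of the null remainder null.\<close>

lemma emeasure_image_le_secant_slope:
  fixes F :: "real \<Rightarrow> real"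
  assumes mono: "strict_mono F" and Lip: "\<And>x y. dist (F x) (F y) \<le> M * dist x y"
    and S: "S \<in> lmeasurable" and "p \<ge> 0"
    and slope: "\<And>x d. x \<in> S \<Longrightarrow> d > 0 \<Longrightarrow>
      \<exists>a b. a < b \<and> b - a < d \<and> x \<in> {a..b} \<and> F b - F a \<le> p * (b - a)"
  shows "emeasure lebesgue (F ` S) \<le> ennreal p * emeasure lebesgue S"
proof -
  have *: "emeasure lebesgue (F ` S) \<le> ennreal p * (emeasure lebesgue S + ennreal e)" if e: "e > 0" for e
  proof -
    obtain U where U: "open U" "S \<subseteq> U" "U - S \<in> lmeasurable" "emeasure lebesgue (U - S) < ennreal e"
      by (rule sets_lebesgue_outer_open[of S e]) (use S e in auto)
    have fine: "\<exists>c r. 0 < r \<and> r < d \<and> x \<in> cball c r \<and> F (c + r) - F (c - r) \<le> p * (2 * r)"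
      if xd: "x \<in> S" "d > 0" for x d
    proof -
      obtain a b where ab: "a < b" "b - a < d" "x \<in> {a..b}" "F b - F a \<le> p * (b - a)"
        using slope[OF xd] by blast
      have eqs: "(a+b)/2 + (b-a)/2 = b" "(a+b)/2 - (b-a)/2 = a" by (simp_all add: field_simps)
      show ?thesis
        by (rule exI[of _ "(a+b)/2"], rule exI[of _ "(b-a)/2"])
          (use ab in \<open>simp add: cball_eq_atLeastAtMost eqs right_diff_distrib\<close>)
    qed
    obtain C where C: "countable C"
      "\<And>c r. (c, r) \<in> C \<Longrightarrow> 0 < r \<and> cball c r \<subseteq> U \<and> F (c + r) - F (c - r) \<le> p * (2 * r)"
      "disjoint_family_on (\<lambda>i. cball (fst i) (snd i)) C"
      "negligible (S - (\<Union>i\<in>C. cball (fst i) (snd i)))"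
      by (rule Vitali_fine_cover[OF U(1,2) fine]) auto
    define I where "I i = {F (fst i - snd i) .. F (fst i + snd i)}" for i
    have disj: "disjoint_family_on I C"
      unfolding disjoint_family_on_def
    proof (intro ballI impI)
      fix i j assume ij: "i \<in> C" "j \<in> C" "i \<noteq> j"
      have "cball (fst i) (snd i) \<inter> cball (fst j) (snd j) = {}"
        using C(3) ij by (auto simp: disjoint_family_on_def)
      moreover have "snd i > 0" "snd j > 0" using C(2) ij by (metis prod.collapse)+
      ultimately have "fst i + snd i < fst j - snd j \<or> fst j + snd j < fst i - snd i"
        unfolding cball_eq_atLeastAtMost by auto
      then have "F (fst i + snd i) < F (fst j - snd j) \<or> F (fst j + snd j) < F (fst i - snd i)"
        using mono by (simp add: strict_mono_less)
      then show "I i \<inter> I j = {}"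
        unfolding I_def by auto
    qed
    have sub: "F ` S \<subseteq> (\<Union>i\<in>C. I i) \<union> F ` (S - (\<Union>i\<in>C. cball (fst i) (snd i)))"
    proof
      fix y assume "y \<in> F ` S"
      then obtain x where x: "x \<in> S" "y = F x" by auto
      show "y \<in> (\<Union>i\<in>C. I i) \<union> F ` (S - (\<Union>i\<in>C. cball (fst i) (snd i)))"
      proof (cases "x \<in> (\<Union>i\<in>C. cball (fst i) (snd i))")
        case True
        then obtain i where i: "i \<in> C" "fst i - snd i \<le> x" "x \<le> fst i + snd i"
          by (auto simp: cball_eq_atLeastAtMost)
        then have "y \<in> I i" unfolding I_def using x mono by (auto simp: strict_mono_less_eq)
        then show ?thesis using i by auto
      qed (use x in auto)
    qed
    have neg: "F ` (S - (\<Union>i\<in>C. cball (fst i) (snd i))) \<in> null_sets lebesgue"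
      using negligible_Lipschitz_image[OF _ C(4) Lip] by (simp add: negligible_iff_null_sets)
    have "emeasure lebesgue (F ` S) \<le> emeasure lebesgue ((\<Union>i\<in>C. I i) \<union> F ` (S - (\<Union>i\<in>C. cball (fst i) (snd i))))"
      using C(1) neg by (intro emeasure_mono[OF sub] sets.Un sets.countable_UN'') (auto simp: I_def)
    also have "\<dots> = emeasure lebesgue (\<Union>i\<in>C. I i)"
      using C(1) by (intro emeasure_Un_null_set neg sets.countable_UN'') (auto simp: I_def)
    also have "\<dots> = (\<integral>\<^sup>+i. emeasure lebesgue (I i) \<partial>count_space C)"
    proof (rule emeasure_UN_countable)
      show "I i \<in> sets lebesgue" if "i \<in> C" for i by (simp add: I_def)
    qed (fact C(1) disj)+
    also have "\<dots> \<le> (\<integral>\<^sup>+i. ennreal p * emeasure lebesgue (cball (fst i) (snd i)) \<partial>count_space C)"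
    proof (rule nn_integral_mono)
      fix i assume "i \<in> space (count_space C)"
      then have i: "0 < snd i" "F (fst i + snd i) - F (fst i - snd i) \<le> p * (2 * snd i)"
        using C(2)[of "fst i" "snd i"] by auto
      then have "F (fst i - snd i) \<le> F (fst i + snd i)" using mono by (simp add: strict_mono_less_eq)
      then show "emeasure lebesgue (I i) \<le> ennreal p * emeasure lebesgue (cball (fst i) (snd i))"
        using i \<open>p \<ge> 0\<close> by (auto simp: I_def cball_eq_atLeastAtMost ennreal_mult[symmetric] intro!: ennreal_leI)
    qed
    also have "\<dots> = ennreal p * emeasure lebesgue (\<Union>i\<in>C. cball (fst i) (snd i))"
      using C by (subst emeasure_UN_countable) (auto simp: nn_integral_cmult)
    also have "\<dots> \<le> ennreal p * emeasure lebesgue U"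
      using U(1) C(2) by (intro mult_left_mono emeasure_mono) (auto simp: subset_eq)
    also have "emeasure lebesgue U = emeasure lebesgue S + emeasure lebesgue (U - S)"
      using U S by (subst plus_emeasure) (auto simp: Un_absorb1)
    also have "\<dots> \<le> emeasure lebesgue S + ennreal e"
      using U(4) by (intro add_left_mono) auto
    finally show ?thesis by (simp add: mult_left_mono)
  qed
  show ?thesis
  proof (rule ennreal_le_epsilon)
    fix e :: real assume "0 < e"
    have "emeasure lebesgue (F ` S) \<le> ennreal p * (emeasure lebesgue S + ennreal (e / (p + 1)))"
      using * \<open>0 < e\<close> \<open>p \<ge> 0\<close> by auto
    also have "\<dots> = ennreal p * emeasure lebesgue S + ennreal (p * (e / (p + 1)))"
      using \<open>0 < e\<close> \<open>p \<ge> 0\<close> by (subst ennreal_mult) (simp_all add: distrib_left)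
    also have "\<dots> \<le> ennreal p * emeasure lebesgue S + ennreal e"
      using \<open>0 < e\<close> \<open>p \<ge> 0\<close> by (intro add_left_mono ennreal_leI) (auto simp: field_simps)
    finally show "emeasure lebesgue (F ` S) \<le> ennreal p * emeasure lebesgue S + ennreal e" .
  qed
qed

text \<open>Strict inequalities and the countable scales 1/(n+1) make this a countable intersection
  of open sets for continuous \<open>f\<close>. A Lipschitz \<open>f\<close> without a derivative
  along \<open>e\<close> at a point has that point in such a set for some rationals p < q.\<close>

definition oscillation_set ::
  "('a::real_normed_vector \<Rightarrow> real) \<Rightarrow> 'a \<Rightarrow> real \<Rightarrow> real \<Rightarrow> 'a set" where
  "oscillation_set f e p q = {x. \<forall>n.
     (\<exists>h. 0 < \<bar>h\<bar> \<and> \<bar>h\<bar> < 1 / Suc n \<and> (f (x + h *\<^sub>R e) - f x) / h < p) \<and>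
     (\<exists>h. 0 < \<bar>h\<bar> \<and> \<bar>h\<bar> < 1 / Suc n \<and> q < (f (x + h *\<^sub>R e) - f x) / h)}"

lemma borel_oscillation_set:
  assumes "continuous_on UNIV f"
  shows "oscillation_set f e p q \<in> sets borel"
proof -
  have "continuous_on UNIV (\<lambda>x. f (x + h *\<^sub>R e))" for h
    by (rule continuous_on_compose2[OF assms]) (auto intro: continuous_intros)
  then have quot: "continuous_on UNIV (\<lambda>x. (f (x + h *\<^sub>R e) - f x) / h)" for h
    unfolding divide_inverse by (intro continuous_intros assms)
  have 1: "open {x. (f (x + h *\<^sub>R e) - f x) / h < p}" "open {x. q < (f (x + h *\<^sub>R e) - f x) / h}" for h
    by (rule open_Collect_less[OF quot continuous_on_const] open_Collect_less[OF continuous_on_const quot])+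
  have "oscillation_set f e p q = (\<Inter>n::nat.
     (\<Union>h\<in>{h. 0 < \<bar>h\<bar> \<and> \<bar>h\<bar> < 1 / Suc n}. {x. (f (x + h *\<^sub>R e) - f x) / h < p}) \<inter>
     (\<Union>h\<in>{h. 0 < \<bar>h\<bar> \<and> \<bar>h\<bar> < 1 / Suc n}. {x. q < (f (x + h *\<^sub>R e) - f x) / h}))"
    by (rule set_eqI) (simp add: oscillation_set_def Bex_def conj_assoc)
  also have "\<dots> \<in> sets borel"
  proof (rule sets.countable_INT')
    show "(\<lambda>n. (\<Union>h\<in>{h. 0 < \<bar>h\<bar> \<and> \<bar>h\<bar> < 1 / Suc n}. {x. (f (x + h *\<^sub>R e) - f x) / h < p}) \<inter>
       (\<Union>h\<in>{h. 0 < \<bar>h\<bar> \<and> \<bar>h\<bar> < 1 / Suc n}. {x. q < (f (x + h *\<^sub>R e) - f x) / h}))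
       ` UNIV \<subseteq> sets borel"
      by (intro image_subsetI borel_open open_Int open_UN ballI 1)
  qed auto
  finally show ?thesis .
qed

lemma oscillation_setD:
  assumes "x \<in> oscillation_set f e p q" "d > 0"
  obtains h k where "0 < \<bar>h\<bar>" "\<bar>h\<bar> < d" "(f (x + h *\<^sub>R e) - f x) / h < p"
    "0 < \<bar>k\<bar>" "\<bar>k\<bar> < d" "q < (f (x + k *\<^sub>R e) - f x) / k"
proof -
  obtain n where n: "1 / real (Suc n) < d"
    using nat_approx_posE[OF \<open>d > 0\<close>] by blast
  obtain h k where "0 < \<bar>h\<bar>" "\<bar>h\<bar> < 1 / real (Suc n)" "(f (x + h *\<^sub>R e) - f x) / h < p"
    "0 < \<bar>k\<bar>" "\<bar>k\<bar> < 1 / real (Suc n)" "q < (f (x + k *\<^sub>R e) - f x) / k"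
    using assms(1) unfolding oscillation_set_def by blast
  then show ?thesis
    using n that[of h k] by linarith
qed

text \<open>After adding a linear function, \<open>f\<close> becomes a bi-Lipschitz homeomorphism \<open>F\<close>. On the
  oscillation set \<open>E\<close>, comparing secant slopes for \<open>F\<close> and for its inverse gives
  \<open>Q |E| \<le> |F(E)| \<le> P |E|\<close> with \<open>P < Q\<close>.\<close>
lemma negligible_oscillation_set_real:
  fixes f :: "real \<Rightarrow> real"
  assumes Lip: "\<And>x y. dist (f x) (f y) \<le> L * dist x y" and "p < q"
  shows "negligible (oscillation_set f 1 p q)"
proof -
  \<comment> \<open>The slope L+1 moves all secant slopes from [-L, L] into [1, 2L+1], so
    \<open>F\<close> and its inverse are both Lipschitz.\<close>
  define F where "F x = f x + (L + 1) * x" for x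
  have L0: "L \<ge> 0" using Lip[of 0 1] by (simp add: dist_real_def)
  have fL: "\<bar>f x - f y\<bar> \<le> L * \<bar>x - y\<bar>" for x y using Lip by (simp add: dist_real_def)
  have low: "y - x \<le> F y - F x" if "x \<le> y" for x y
    using fL[of x y] that by (simp add: F_def algebra_simps abs_le_iff)
  have F_mono: "strict_mono F"
  proof (rule strict_monoI)
    show "F x < F y" if "x < y" for x y using low[of x y] that by simp
  qed
  have F_Lip: "dist (F x) (F y) \<le> (2 * L + 1) * dist x y" for x y
  proof -
    have "\<bar>F x - F y\<bar> \<le> \<bar>f x - f y\<bar> + \<bar>(L+1) * (x - y)\<bar>"
      by (simp add: F_def algebra_simps)
    also have "\<dots> \<le> L * \<bar>x - y\<bar> + (L+1) * \<bar>x-y\<bar>"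
      using fL[of x y] L0 by (simp add: abs_mult)
    finally show ?thesis by (simp add: dist_real_def algebra_simps)
  qed
  have F_cont: "continuous_on S F" for S
    by (rule lipschitz_on_continuous_on[of "2 * L + 1"], rule lipschitz_onI) (use F_Lip L0 in auto)
  have F_surj: "\<exists>x. F x = y" for y
  proof -
    define R where "R = \<bar>y - F 0\<bar>"
    have "F (-R) \<le> y" "y \<le> F R" using low[of "-R" 0] low[of 0 R] by (auto simp: R_def)
    then show ?thesis
      using IVT'[of F "-R" y R] F_cont by (auto simp: R_def)
  qed
  define G where "G = inv F"
  have bij: "bij F" using F_mono F_surj by (metis bij_def strict_mono_imp_inj_on surj_def)
  have FG: "F (G y) = y" "G (F y) = y" for y
    using bij by (auto simp: G_def bij_is_surj surj_f_inv_f bij_is_inj inv_f_f)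
  have G_mono: "strict_mono G"
    by (rule strict_monoI) (metis FG(1) F_mono strict_mono_less)
  have G_Lip: "dist (G x) (G y) \<le> 1 * dist x y" for x y
  proof (cases "G x \<le> G y")
    case True
    have "G y - G x \<le> y - x" using low[OF True] by (simp only: FG)
    with True show ?thesis by (simp add: dist_real_def)
  next
    case False
    have "G x - G y \<le> x - y" using low[of "G y" "G x"] False by (simp add: FG)
    with False show ?thesis by (simp add: dist_real_def)
  qed
  have G_meas: "G \<in> borel_measurable borel"
    by (rule borel_measurable_mono) (simp add: G_mono strict_mono_mono)
  define E where "E = oscillation_set f 1 p q"
  have E: "E \<in> sets borel"
    unfolding E_def
    by (intro borel_oscillation_set lipschitz_on_continuous_on[of L] lipschitz_onI)
      (use Lip L0 in auto)
  have sec: "\<exists>a b. a < b \<and> b - a < d \<and> x \<in> {a..b} \<and> F b - F a \<le> (p + L + 1) * (b - a)"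
            "\<exists>a b. a < b \<and> b - a < d \<and> x \<in> {a..b} \<and> F b - F a \<ge> (q + L + 1) * (b - a)"
    if x: "x \<in> E" and "d > 0" for x d
  proof -
    obtain h k where hk0: "0 < \<bar>h\<bar>" "\<bar>h\<bar> < d" "(f (x + h *\<^sub>R 1) - f x) / h < p"
      "0 < \<bar>k\<bar>" "\<bar>k\<bar> < d" "q < (f (x + k *\<^sub>R 1) - f x) / k"
      using x \<open>d > 0\<close> unfolding E_def by (elim oscillation_setD)
    then have hk: "0 < \<bar>h\<bar>" "\<bar>h\<bar> < d" "(f (x + h) - f x) / h < p"
      "0 < \<bar>k\<bar>" "\<bar>k\<bar> < d" "q < (f (x + k) - f x) / k"
      by simp_all
    \<comment> \<open>A quotient with increment \<open>h\<close> of either sign is the slope over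
      the interval between \<open>x\<close> and \<open>x + h\<close>, with \<open>x\<close> as left
      or right endpoint.\<close>
    have "\<exists>a b. a < b \<and> b - a = \<bar>h\<bar> \<and> x \<in> {a..b} \<and> (F b - F a) / (b - a) = (F (x + h) - F x) / h"
      if "h \<noteq> 0" for h
    proof (cases "h > 0")
      case True then show ?thesis by (intro exI[of _ x] exI[of _ "x + h"]) auto
    next
      case False
      have "(F x - F (x + h)) / (- h) = (F (x + h) - F x) / h"
        using minus_divide_divide[of "F (x + h) - F x" h] by simp
      with False that show ?thesis
        by (intro exI[of _ "x + h"] exI[of _ x]) simp
    qed
    note sec = this
    have eq: "(F (x + h) - F x) / h = (f (x + h) - f x) / h + (L + 1)" if "h \<noteq> 0" for h
      using that by (simp add: F_def field_simps)
    obtain a b where ab: "a < b" "b - a = \<bar>h\<bar>" "x \<in> {a..b}" "(F b - F a) / (b - a) = (F (x + h) - F x) / h"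
      using sec[of h] hk(1) by (metis zero_less_abs_iff)
    have "(F b - F a) / (b - a) < p + L + 1" using ab(4) eq[of h] hk(1,3) by simp
    then have "F b - F a \<le> (p + L + 1) * (b - a)" using ab(1) by (simp add: pos_divide_less_eq)
    then show "\<exists>a b. a < b \<and> b - a < d \<and> x \<in> {a..b} \<and> F b - F a \<le> (p + L + 1) * (b - a)"
      using ab hk(2) by (intro exI[of _ a] exI[of _ b]) simp
    obtain a b where ab: "a < b" "b - a = \<bar>k\<bar>" "x \<in> {a..b}" "(F b - F a) / (b - a) = (F (x + k) - F x) / k"
      using sec[of k] hk(4) by (metis zero_less_abs_iff)
    have "q + L + 1 < (F b - F a) / (b - a)" using ab(4) eq[of k] hk(4,6) by simp
    then have "F b - F a \<ge> (q + L + 1) * (b - a)" using ab(1) by (simp add: pos_less_divide_eq)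
    then show "\<exists>a b. a < b \<and> b - a < d \<and> x \<in> {a..b} \<and> F b - F a \<ge> (q + L + 1) * (b - a)"
      using ab hk(5) by (intro exI[of _ a] exI[of _ b]) simp
  qed
  \<comment> \<open>The final comparison |S| \<le> (P/Q) |S| with P/Q < 1 forces |S| = 0 only if |S|
    is finite, so \<open>E\<close> is cut into bounded pieces.\<close>
  have bdd: "negligible (E \<inter> cball 0 (real n))" for n
  proof (cases "E \<inter> cball 0 (real n) = {}")
    case False
    define S where "S = E \<inter> cball 0 (real n)"
    have SE: "x \<in> E" if "x \<in> S" for x using that by (simp add: S_def)
    have Sm: "S \<in> lmeasurable"
      using E by (auto simp: S_def intro!: bounded_set_imp_lmeasurable borel_closed)
    define P Q where "P = p + L + 1" and "Q = q + L + 1"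
    \<comment> \<open>A single point of \<open>S\<close> provides a secant of slope at most
      \<open>P\<close>, while every secant of \<open>F\<close> has slope at least 1.\<close>
    obtain x where "x \<in> S" using False S_def by blast
    then obtain a b where "a < b" "F b - F a \<le> P * (b - a)" using sec(1)[of x 1] SE by (auto simp: P_def)
    with low[of a b] have "P \<ge> 1"
      by (smt (verit, best) mult_le_cancel_right1 mult_right_less_imp_less)
    then have "Q > 1" using \<open>p < q\<close> by (simp add: P_def Q_def)
    have 1: "emeasure lebesgue (F ` S) \<le> ennreal P * emeasure lebesgue S"
      by (rule emeasure_image_le_secant_slope[OF F_mono F_Lip Sm])
        (use sec(1)[OF SE] \<open>P \<ge> 1\<close> in \<open>simp_all add: P_def\<close>)
    have FS: "F ` S = G -` S"
    proof (intro equalityI subsetI)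
      fix y assume "y \<in> G -` S"
      then show "y \<in> F ` S" using FG(1)[of y] by (metis imageI vimageD)
    qed (use FG(2) in auto)
    have "F ` S \<in> sets borel"
      using measurable_sets[OF G_meas, of S] E unfolding FS by (simp add: S_def)
    moreover have "bounded (F ` S)"
      by (rule bounded_subset[OF compact_imp_bounded[OF compact_continuous_image[OF F_cont compact_cball]]])
        (auto simp: S_def)
    ultimately have FSm: "F ` S \<in> lmeasurable"
      by (intro bounded_set_imp_lmeasurable) auto
    have 2: "emeasure lebesgue (G ` (F ` S)) \<le> ennreal (1 / Q) * emeasure lebesgue (F ` S)"
    proof (rule emeasure_image_le_secant_slope[OF G_mono G_Lip FSm])
      fix y d :: real assume "y \<in> F ` S" "d > 0"
      then obtain x where x: "x \<in> S" "y = F x" by auto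
      \<comment> \<open>Inverting \<open>F\<close> turns slopes at least \<open>Q\<close> into
        slopes at most 1/Q. The scale is divided by 2L+1 so that the image interval, on which the
        slope of \<open>G\<close> is taken, is shorter than \<open>d\<close>.\<close>
      obtain a b where ab: "a < b" "b - a < d / (2 * L + 1)" "x \<in> {a..b}" "F b - F a \<ge> Q * (b - a)"
        using sec(2)[of x "d / (2 * L + 1)"] SE[OF x(1)] L0 \<open>d > 0\<close> by (auto simp: Q_def)
      have "F b - F a \<le> (2 * L + 1) * (b - a)" using F_Lip[of b a] ab by (simp add: dist_real_def)
      also have "\<dots> < d" using ab(2) L0 by (simp add: field_simps)
      finally have "F b - F a < d" .
      then show "\<exists>a b. a < b \<and> b - a < d \<and> y \<in> {a..b} \<and> G b - G a \<le> 1 / Q * (b - a)"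
        using ab x F_mono \<open>Q > 1\<close>
        by (intro exI[of _ "F a"] exI[of _ "F b"])
          (auto simp: FG strict_mono_less strict_mono_less_eq field_simps)
    qed (use \<open>Q > 1\<close> in auto)
    have "G ` (F ` S) = S" using FG by (auto simp: image_image)
    then have "emeasure lebesgue S \<le> ennreal (1 / Q) * (ennreal P * emeasure lebesgue S)"
      using 2 mult_left_mono[OF 1, of "ennreal (1/Q)"] by (auto intro: order_trans)
    also have "\<dots> = ennreal (P / Q) * emeasure lebesgue S"
      using \<open>P \<ge> 1\<close> \<open>Q > 1\<close> by (simp add: mult.assoc[symmetric] ennreal_mult[symmetric])
    finally have *: "emeasure lebesgue S \<le> ennreal (P / Q) * emeasure lebesgue S" .
    have "measure lebesgue S \<le> P / Q * measure lebesgue S"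
    proof -
      have eq: "emeasure lebesgue S = ennreal (measure lebesgue S)"
        using Sm by (simp add: emeasure_eq_measure2 fmeasurableD2)
      show ?thesis
        using * \<open>P \<ge> 1\<close> \<open>Q > 1\<close> unfolding eq by (simp add: ennreal_mult[symmetric])
    qed
    moreover have "P / Q < 1" using \<open>P \<ge> 1\<close> \<open>Q > 1\<close> \<open>p < q\<close> by (simp add: P_def Q_def)
    ultimately have "measure lebesgue S = 0"
      by (smt (verit) measure_nonneg mult_le_cancel_right1)
    then show ?thesis using Sm by (simp add: S_def negligible_iff_measure)
  qed simp
  have "E = (\<Union>n. E \<inter> cball 0 (real n))"
    using real_arch_simple by (auto simp: dist_real_def)
  then show ?thesis
    using bdd negligible_countable_Union[of "range (\<lambda>n. E \<inter> cball 0 (real n))"] by (auto simp: E_def)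
qed

section \<open>Density points and Rademacher's theorem in the plane\<close>

text \<open>The limit is the lower limit \<open>Sup X\<close>, where \<open>X\<close> collects the
  eventual lower bounds. A rational p slightly above it is not an eventual lower bound, so the
  absence of oscillation makes the next rational q an eventual upper bound. Restricting to rationals
  leaves countably many exceptional sets later on.\<close>

lemma tendsto_if_no_oscillation:
  fixes g :: "real \<Rightarrow> real"
  assumes bound: "\<And>h. \<bar>g h\<bar> \<le> B"
    and no_osc: "\<And>p q. p \<in> \<rat> \<Longrightarrow> q \<in> \<rat> \<Longrightarrow> p < q \<Longrightarrow>
      \<exists>d>0. (\<forall>h. 0 < \<bar>h\<bar> \<and> \<bar>h\<bar> < d \<longrightarrow> p \<le> g h) \<or> (\<forall>h. 0 < \<bar>h\<bar> \<and> \<bar>h\<bar> < d \<longrightarrow> g h \<le> q)"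
  shows "\<exists>l. (g \<longlongrightarrow> l) (at 0)"
proof -
  have ev: "eventually P (at 0) \<longleftrightarrow> (\<exists>d>0. \<forall>h. 0 < \<bar>h\<bar> \<and> \<bar>h\<bar> < d \<longrightarrow> P h)" for P :: "real \<Rightarrow> bool"
    by (simp add: eventually_at dist_real_def)
  define X where "X = {p. \<forall>\<^sub>F h in at 0. p \<le> g h}"
  have "-B \<le> g h" for h using bound[of h] by linarith
  then have "-B \<in> X" by (simp add: X_def)
  have bdd: "p \<le> B" if "p \<in> X" for p
  proof -
    have "\<exists>h. p \<le> g h" using that eventually_happens[of "\<lambda>h. p \<le> g h" "at 0"] by (auto simp: X_def)
    then show ?thesis using bound by (meson abs_le_D1 order_trans)
  qed
  then have bX: "bdd_above X" by (auto simp: bdd_above_def)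
  have "(g \<longlongrightarrow> Sup X) (at 0)"
  proof (rule order_tendstoI)
    fix a assume "a < Sup X"
    then obtain p where "p \<in> X" "a < p" using less_cSup_iff[of X a] \<open>-B \<in> X\<close> bX by blast
    then show "\<forall>\<^sub>F h in at 0. a < g h"
      unfolding X_def by (auto elim: eventually_mono)
  next
    fix a assume "Sup X < a"
    obtain p where p: "p \<in> \<rat>" "Sup X < p" "p < a" using Rats_dense_in_real[OF \<open>Sup X < a\<close>] by blast
    obtain q where q: "q \<in> \<rat>" "p < q" "q < a" using Rats_dense_in_real[OF \<open>p < a\<close>] by blast
    have "p \<notin> X" using p(2) bX cSup_upper[of p X] by auto
    then have "\<not> (\<exists>d>0. \<forall>h. 0 < \<bar>h\<bar> \<and> \<bar>h\<bar> < d \<longrightarrow> p \<le> g h)"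
      unfolding X_def mem_Collect_eq ev by blast
    then obtain d where "d > 0" "\<forall>h. 0 < \<bar>h\<bar> \<and> \<bar>h\<bar> < d \<longrightarrow> g h \<le> q"
      using no_osc[OF p(1) q(1,2)] by blast
    then show "\<forall>\<^sub>F h in at 0. g h < a"
      unfolding ev using q(3) by (meson le_less_trans)
  qed
  then show ?thesis by blast
qed

text \<open>Tonelli: every slice parallel to the direction is the oscillation set of a Lipschitz
  function of one variable, hence null.\<close>

lemma negligible_oscillation_set_prod:
  fixes f :: "real \<times> real \<Rightarrow> real"
  assumes Lip: "\<And>x y. dist (f x) (f y) \<le> L * dist x y" and "p < q"
  shows "negligible (oscillation_set f (1, 0) p q)" "negligible (oscillation_set f (0, 1) p q)"
proof -
  have L0: "L \<ge> 0" using Lip[of "(0,0)" "(1,0)"] zero_le_dist[of "f (0,0)" "f (1,0)"]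
    by (simp add: dist_Pair_Pair dist_real_def)
  have cont: "continuous_on UNIV f"
    by (rule lipschitz_on_continuous_on[of L], rule lipschitz_onI) (use Lip L0 in auto)
  have B: "oscillation_set f e p q \<in> sets (lborel \<Otimes>\<^sub>M lborel)" for e
    unfolding lborel_prod using borel_oscillation_set[OF cont] by simp
  have null: "oscillation_set (g :: real \<Rightarrow> real) 1 p q \<in> null_sets lborel"
    if g: "\<And>x y. dist (g x) (g y) \<le> L * dist x y" for g
  proof -
    have "continuous_on UNIV g"
      by (rule lipschitz_on_continuous_on[of L], rule lipschitz_onI) (use g L0 in auto)
    then show ?thesis
      using negligible_oscillation_set_real[OF g \<open>p < q\<close>] borel_oscillation_set[of g 1 p q]
      by (simp add: negligible_iff_null_sets null_sets_completion_iff)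
  qed
  have s1: "(\<lambda>x. (x, y)) -` oscillation_set f (1, 0) p q = oscillation_set (\<lambda>x. f (x, y)) 1 p q" for y
    by (simp add: oscillation_set_def vimage_def)
  have s2: "Pair x -` oscillation_set f (0, 1) p q = oscillation_set (\<lambda>y. f (x, y)) 1 p q" for x
    by (simp add: oscillation_set_def vimage_def)
  have "emeasure (lborel \<Otimes>\<^sub>M lborel) (oscillation_set f (1, 0) p q) =
      (\<integral>\<^sup>+y. emeasure lborel ((\<lambda>x. (x, y)) -` oscillation_set f (1, 0) p q) \<partial>lborel)"
    by (rule lborel_pair.emeasure_pair_measure_alt2[OF B])
  also have "\<dots> = (\<integral>\<^sup>+y. 0 \<partial>(lborel :: real measure))"
    unfolding s1
  proof (intro nn_integral_cong null_setsD1 null)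
    show "dist (f (x, y)) (f (x', y)) \<le> L * dist x x'" for x x' y
      using Lip[of "(x,y)" "(x',y)"] by (simp add: dist_Pair_Pair)
  qed
  finally show "negligible (oscillation_set f (1, 0) p q)"
    using B[of "(1, 0)"] unfolding lborel_prod
    by (simp add: negligible_iff_null_sets null_sets_completion_iff null_sets_def)
  have "emeasure (lborel \<Otimes>\<^sub>M lborel) (oscillation_set f (0, 1) p q) =
      (\<integral>\<^sup>+x. emeasure lborel (Pair x -` oscillation_set f (0, 1) p q) \<partial>lborel)"
    by (rule lborel.emeasure_pair_measure_alt[OF B])
  also have "\<dots> = (\<integral>\<^sup>+x. 0 \<partial>(lborel :: real measure))"
    unfolding s2
  proof (intro nn_integral_cong null_setsD1 null)
    show "dist (f (x, y)) (f (x, y')) \<le> L * dist y y'" for x y y'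
      using Lip[of "(x,y)" "(x,y')"] by (simp add: dist_Pair_Pair)
  qed
  finally show "negligible (oscillation_set f (0, 1) p q)"
    using B[of "(0, 1)"] unfolding lborel_prod
    by (simp add: negligible_iff_null_sets null_sets_completion_iff null_sets_def)
qed

text \<open>One half of Lebesgue's density theorem. Disjoint Vitali balls inside an open
  \<open>U\<close> with |U - A| < e t each have at least the fraction \<open>e\<close> of their
  measure outside \<open>A\<close>, so together they measure less than \<open>t\<close>, and they
  cover the set up to a null set.\<close>

lemma negligible_low_density:
  fixes A :: "'a::euclidean_space set"
  assumes A: "A \<in> sets lebesgue" and "e > 0"
  shows "negligible {x \<in> A. \<forall>d>0. \<exists>r. 0 < r \<and> r < d \<and>
    ennreal e * emeasure lebesgue (cball x r) \<le> emeasure lebesgue (cball x r - A)}"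
    (is "negligible ?P")
  unfolding negligible_outer_le
proof (intro allI impI)
  fix t :: real assume "t > 0"
  then have "0 < e * t" using \<open>e > 0\<close> by simp
  obtain U where U: "open U" "A \<subseteq> U" "U - A \<in> lmeasurable" "emeasure lebesgue (U - A) < ennreal (e * t)"
    by (rule sets_lebesgue_outer_open[OF A \<open>0 < e * t\<close>])
  define Q where "Q c r \<longleftrightarrow> ennreal e * emeasure lebesgue (cball c r) \<le> emeasure lebesgue (cball c r - A)"
    for c r
  have fine: "\<exists>c r. 0 < r \<and> r < d \<and> x \<in> cball c r \<and> Q c r" if "x \<in> ?P" "0 < d" for x d
  proof -
    have "\<exists>r. 0 < r \<and> r < d \<and> Q x r" unfolding Q_def using that(1) \<open>0 < d\<close> by simp
    then obtain r where "0 < r" "r < d" "Q x r" by (elim exE conjE)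
    then show ?thesis by (intro exI[of _ x] exI[of _ r]) simp
  qed
  have PU: "?P \<subseteq> U" using U(2) by blast
  obtain C where C: "countable C" "\<And>c r. (c, r) \<in> C \<Longrightarrow> 0 < r \<and> cball c r \<subseteq> U \<and> Q c r"
    "disjoint_family_on (\<lambda>i. cball (fst i) (snd i)) C"
    "negligible (?P - (\<Union>i\<in>C. cball (fst i) (snd i)))"
  proof (rule Vitali_fine_cover[where P = Q, OF U(1) PU fine])
    fix C assume "countable C" "\<And>c r. (c, r) \<in> C \<Longrightarrow> 0 < r \<and> cball c r \<subseteq> U \<and> Q c r"
      "disjoint_family_on (\<lambda>i. cball (fst i) (snd i)) C"
      "negligible (?P - (\<Union>i\<in>C. cball (fst i) (snd i)))"
    then show thesis by (rule that)
  qed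
  define W where "W = (\<Union>i\<in>C. cball (fst i) (snd i))"
  have Wm: "W \<in> sets lebesgue" unfolding W_def using C(1) by (intro sets.countable_UN'') auto
  have m1: "emeasure lebesgue W = (\<integral>\<^sup>+i. emeasure lebesgue (cball (fst i) (snd i)) \<partial>count_space C)"
    unfolding W_def by (rule emeasure_UN_countable[OF _ C(1,3)]) simp
  have dj: "disjoint_family_on (\<lambda>i. cball (fst i) (snd i) - A) C"
    using C(3) unfolding disjoint_family_on_def by blast
  have "ennreal e * emeasure lebesgue W =
      (\<integral>\<^sup>+i. ennreal e * emeasure lebesgue (cball (fst i) (snd i)) \<partial>count_space C)"
    unfolding m1 by (rule nn_integral_cmult[symmetric]) simp
  also have "\<dots> \<le> (\<integral>\<^sup>+i. emeasure lebesgue (cball (fst i) (snd i) - A) \<partial>count_space C)"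
  proof (rule nn_integral_mono)
    fix i assume "i \<in> space (count_space C)"
    then show "ennreal e * emeasure lebesgue (cball (fst i) (snd i)) \<le> emeasure lebesgue (cball (fst i) (snd i) - A)"
      using C(2)[of "fst i" "snd i"] by (simp add: Q_def)
  qed
  also have "\<dots> = emeasure lebesgue (\<Union>i\<in>C. cball (fst i) (snd i) - A)"
    by (rule emeasure_UN_countable[OF _ C(1) dj, symmetric]) (intro sets.Diff A sets_lebesgue_cball)
  also have "\<dots> \<le> emeasure lebesgue (U - A)"
  proof (rule emeasure_mono)
    show "(\<Union>i\<in>C. cball (fst i) (snd i) - A) \<subseteq> U - A"
    proof
      fix x assume "x \<in> (\<Union>i\<in>C. cball (fst i) (snd i) - A)"
      then obtain i where "i \<in> C" "x \<in> cball (fst i) (snd i)" "x \<notin> A" by blast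
      then show "x \<in> U - A" using C(2)[of "fst i" "snd i"] by auto
    qed
  qed (use U in auto)
  also have "\<dots> < ennreal e * ennreal t"
    using U(4) \<open>e > 0\<close> \<open>t > 0\<close> by (simp add: ennreal_mult)
  finally have "ennreal e * emeasure lebesgue W < ennreal e * ennreal t" .
  then have "emeasure lebesgue W < ennreal t"
    by (meson mult_left_mono not_le zero_le)
  then have "emeasure lebesgue W < \<infinity>" "measure lebesgue W \<le> t"
    unfolding measure_def using \<open>t > 0\<close>
    by (simp_all add: enn2real_leI order.strict_trans[OF _ ennreal_less_top])
  then have Wl: "W \<in> lmeasurable" "measure lebesgue W \<le> t"
    using Wm by (auto intro: fmeasurableI)
  have null: "negligible (?P - W)" using C(4) unfolding W_def .
  have "W \<union> (?P - W) \<in> lmeasurable"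
    by (rule fmeasurable.Un[OF Wl(1) negligible_imp_measurable[OF null]])
  moreover have "measure lebesgue (W \<union> (?P - W)) \<le> t"
    using measure_Un_le[of W lebesgue "?P - W"] Wl negligible_imp_measure0[OF null]
      negligible_imp_sets[OF null] Wm by linarith
  ultimately show "\<exists>T. ?P \<subseteq> T \<and> T \<in> lmeasurable \<and> measure lebesgue T \<le> t"
    by (intro exI[of _ "W \<union> (?P - W)"] conjI) (simp only: Un_Diff_cancel Un_upper2)+
qed

text \<open>A hole of radius k r around a point of \<open>cball x r\<close> lies in
  \<open>cball x (2 * r)\<close> because k \<le> 1, and it fills the fraction (k/2)^n of that ball,
  n being the dimension. So porous points have low density at arbitrarily small scales.\<close>

lemma negligible_porous_points:
  fixes A :: "'a::euclidean_space set"
  assumes A: "A \<in> sets lebesgue" and k: "0 < k" "k \<le> 1"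
  shows "negligible {x \<in> A. \<forall>d>0. \<exists>r y. 0 < r \<and> r < d \<and> y \<in> cball x r \<and> cball y (k * r) \<inter> A = {}}"
proof (rule negligible_subset[OF negligible_low_density[OF A, of "(k/2) ^ DIM('a)"]])
  show "{x \<in> A. \<forall>d>0. \<exists>r y. 0 < r \<and> r < d \<and> y \<in> cball x r \<and> cball y (k * r) \<inter> A = {}}
    \<subseteq> {x \<in> A. \<forall>d>0. \<exists>r>0. r < d \<and> ennreal ((k / 2) ^ DIM('a)) * emeasure lebesgue (cball x r)
        \<le> emeasure lebesgue (cball x r - A)}"
  proof safe
    fix x and d :: real
    assume "x \<in> A" "d > 0"
      and *: "\<forall>d>0. \<exists>r y. 0 < r \<and> r < d \<and> y \<in> cball x r \<and> cball y (k * r) \<inter> A = {}"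
    obtain r y where r: "0 < r" "r < d/2" "y \<in> cball x r" "cball y (k * r) \<inter> A = {}"
      using *[rule_format, of "d/2"] \<open>d > 0\<close> by auto
    have sub: "cball y (k * r) \<subseteq> cball x (2 * r) - A"
    proof
      fix z assume z: "z \<in> cball y (k * r)"
      have "dist x z \<le> dist x y + dist y z" by (rule dist_triangle)
      also have "\<dots> \<le> r + k * r" using z r(3) by simp
      also have "k * r \<le> r" using k r(1) by simp
      finally show "z \<in> cball x (2 * r) - A" using z r(4) by auto
    qed
    have "ennreal ((k / 2) ^ DIM('a)) * emeasure lebesgue (cball x (2 * r)) =
        ennreal ((k / 2) ^ DIM('a) * (unit_ball_vol (DIM('a)) * (2 * r) ^ DIM('a)))"
      using r(1) k by (simp add: emeasure_cball ennreal_mult)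
    also have "(k / 2) ^ DIM('a) * (unit_ball_vol (DIM('a)) * (2 * r) ^ DIM('a)) =
        unit_ball_vol (DIM('a)) * (k * r) ^ DIM('a)"
      by (simp add: power_mult_distrib power_divide)
    also have "ennreal \<dots> = emeasure lebesgue (cball y (k * r))"
      using r(1) k by (simp add: emeasure_cball)
    also have "\<dots> \<le> emeasure lebesgue (cball x (2 * r) - A)"
      using A by (intro emeasure_mono[OF sub]) auto
    finally show "\<exists>r>0. r < d \<and> ennreal ((k / 2) ^ DIM('a)) * emeasure lebesgue (cball x r)
        \<le> emeasure lebesgue (cball x r - A)"
      using r(1,2) by (intro exI[of _ "2 * r"]) auto
  qed
qed (use k in simp)

text \<open>The set \<open>A y z n m\<close> consists of the points with partial derivatives uniformly close to
  \<open>(y, z)\<close>. At a point \<open>x\<close> where \<open>A y z n m\<close> is not porous, an increment of \<open>f\<close> can be split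
  into a horizontal one from \<open>x\<close> and a vertical one from a nearby point of that set.\<close>
lemma Rademacher_prod:
  fixes f :: "real \<times> real \<Rightarrow> real"
  assumes Lip: "\<And>x y. dist (f x) (f y) \<le> L * dist x y"
  shows "negligible {x. \<not> f differentiable (at x)}"
proof -
  have L0: "L \<ge> 0" using Lip[of "(0,0)" "(1,0)"] zero_le_dist[of "f (0,0)" "f (1,0)"]
    by (simp add: dist_Pair_Pair dist_real_def)
  have cont: "continuous_on UNIV f"
    by (rule lipschitz_on_continuous_on[of L], rule lipschitz_onI) (use Lip L0 in auto)
  define A where "A y z n m = {x. \<forall>t. \<bar>t\<bar> \<le> 1 / real (Suc m) \<longrightarrow>
      \<bar>f (x + t *\<^sub>R (1, 0)) - f x - t * y\<bar> \<le> \<bar>t\<bar> / real (Suc n) \<and>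
      \<bar>f (x + t *\<^sub>R (0, 1)) - f x - t * z\<bar> \<le> \<bar>t\<bar> / real (Suc n)}" for y z :: real and n m
  have closed_A: "closed (A y z n m)" for y z n m
  proof -
    have sh: "continuous_on UNIV (\<lambda>x. f (x + t *\<^sub>R e))" for t and e :: "real \<times> real"
      by (rule continuous_on_compose2[OF cont]) (auto intro: continuous_intros)
    have "A y z n m = (\<Inter>t\<in>{t. \<bar>t\<bar> \<le> 1 / real (Suc m)}.
        {x. \<bar>f (x + t *\<^sub>R (1, 0)) - f x - t * y\<bar> \<le> \<bar>t\<bar> / real (Suc n)} \<inter>
        {x. \<bar>f (x + t *\<^sub>R (0, 1)) - f x - t * z\<bar> \<le> \<bar>t\<bar> / real (Suc n)})"
      by (rule set_eqI) (simp add: A_def)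
    also have "closed \<dots>"
      by (intro closed_INT closed_Int ballI closed_Collect_le continuous_on_const
          continuous_on_rabs continuous_on_diff sh cont)
    finally show ?thesis .
  qed
  \<comment> \<open>The relative size of the holes equals the tolerance 1/(n+1) of \<open>A\<close>,
    so moving a base point across a missing hole costs an error of the same order as the partial
    derivatives do.\<close>
  define P where "P y z n m = {x \<in> A y z n m. \<forall>d>0. \<exists>r w. 0 < r \<and> r < d \<and> w \<in> cball x r \<and>
      cball w (1 / real (Suc n) * r) \<inter> A y z n m = {}}" for y z n m
  have negP: "negligible (P y z n m)" for y z n m
    unfolding P_def
    by (rule negligible_porous_points[of _ "1 / real (Suc n)"])
      (use closed_A in \<open>simp_all add: borel_closed\<close>)
  define N where "N = (\<Union>p\<in>\<rat>. \<Union>q\<in>{q \<in> \<rat>. p < q}. oscillation_set f (1, 0) p q \<union> oscillation_set f (0, 1) p q)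
      \<union> (\<Union>y\<in>\<rat>. \<Union>z\<in>\<rat>. \<Union>n. \<Union>m. P y z n m)"
  have negUN: "negligible (\<Union>i\<in>I. X i)" if "countable I" "\<And>i. i \<in> I \<Longrightarrow> negligible (X i)"
    for X :: "'i \<Rightarrow> (real \<times> real) set" and I
    using that by (intro negligible_countable_Union) auto
  have negN: "negligible N"
    unfolding N_def
    by (intro negligible_Un negUN countable_rat countable_subset[OF _ countable_rat] negP
        negligible_oscillation_set_prod[OF Lip] uncountable_def) auto
  have diff: "f differentiable (at x)" if x: "x \<notin> N" for x
  proof -
    have partial: "\<exists>l. ((\<lambda>t. (f (x + t *\<^sub>R e) - f x) / t) \<longlongrightarrow> l) (at 0)"
      if e: "norm e = 1" and no: "\<And>p q. p \<in> \<rat> \<Longrightarrow> q \<in> \<rat> \<Longrightarrow> p < q \<Longrightarrow> x \<notin> oscillation_set f e p q" for e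
    proof (rule tendsto_if_no_oscillation)
      fix h
      show "\<bar>(f (x + h *\<^sub>R e) - f x) / h\<bar> \<le> L"
        using Lip[of "x + h *\<^sub>R e" x] e L0 by (cases "h = 0") (simp_all add: dist_norm pos_divide_le_eq)
    next
      fix p q :: real assume pq: "p \<in> \<rat>" "q \<in> \<rat>" "p < q"
      obtain n where "\<not> ((\<exists>h. 0 < \<bar>h\<bar> \<and> \<bar>h\<bar> < 1 / Suc n \<and> (f (x + h *\<^sub>R e) - f x) / h < p) \<and>
         (\<exists>h. 0 < \<bar>h\<bar> \<and> \<bar>h\<bar> < 1 / Suc n \<and> q < (f (x + h *\<^sub>R e) - f x) / h))"
        using no[OF pq] unfolding oscillation_set_def mem_Collect_eq not_all by (elim exE)
      then show "\<exists>d>0. (\<forall>h. 0 < \<bar>h\<bar> \<and> \<bar>h\<bar> < d \<longrightarrow> p \<le> (f (x + h *\<^sub>R e) - f x) / h) \<or>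
           (\<forall>h. 0 < \<bar>h\<bar> \<and> \<bar>h\<bar> < d \<longrightarrow> (f (x + h *\<^sub>R e) - f x) / h \<le> q)"
        by (intro exI[of _ "1 / real (Suc n)"] conjI) (simp, meson not_le)
    qed
    obtain a where a: "((\<lambda>t. (f (x + t *\<^sub>R (1, 0)) - f x) / t) \<longlongrightarrow> a) (at 0)"
      using partial[of "(1, 0)"] x by (auto simp: N_def norm_Pair)
    obtain b where b: "((\<lambda>t. (f (x + t *\<^sub>R (0, 1)) - f x) / t) \<longlongrightarrow> b) (at 0)"
      using partial[of "(0, 1)"] x by (auto simp: N_def norm_Pair)
    define D where "D h = a * fst h + b * snd h" for h :: "real \<times> real"
    have "bounded_linear D"
      unfolding D_def
      by (intro bounded_linear_add bounded_linear_const_mult bounded_linear_fst bounded_linear_snd)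
    have "(f has_derivative D) (at x)"
      unfolding has_derivative_at_alt
    proof (intro conjI allI impI \<open>bounded_linear D\<close>)
      fix e :: real assume "e > 0"
      \<comment> \<open>The increment is compared with its linear part through two displacements
        costing L k r each and four errors of k r: two from the partial increments and two from
        rounding (a, b) to the rationals (y, z).\<close>
      define e' where "e' = e / (2 * L + 4)"
      have "e' > 0" using \<open>e > 0\<close> L0 by (simp add: e'_def)
      then obtain n where n: "1 / real (Suc n) < e'" using nat_approx_posE by blast
      define k where "k = 1 / real (Suc n)"
      have k: "k > 0" "k \<le> e'" using n by (simp_all add: k_def)
      obtain y where y: "y \<in> \<rat>" "\<bar>y - a\<bar> < k / 2"
        using Rats_dense_in_real[of "a - k/2" "a + k/2"] k(1) unfolding abs_diff_less_iff by auto
      obtain z where z: "z \<in> \<rat>" "\<bar>z - b\<bar> < k / 2"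
        using Rats_dense_in_real[of "b - k/2" "b + k/2"] k(1) unfolding abs_diff_less_iff by auto
      have near: "\<exists>d>0. \<forall>t. \<bar>t\<bar> < d \<longrightarrow> \<bar>f (x + t *\<^sub>R v) - f x - t * y\<bar> \<le> \<bar>t\<bar> * k"
        if lim: "((\<lambda>t. (f (x + t *\<^sub>R v) - f x) / t) \<longlongrightarrow> a) (at 0)" and y: "\<bar>y - a\<bar> < k / 2" for v a y
      proof -
        obtain d where "d > 0" and d: "\<And>t. t \<noteq> 0 \<Longrightarrow> \<bar>t\<bar> < d \<Longrightarrow> \<bar>(f (x + t *\<^sub>R v) - f x) / t - a\<bar> < k / 2"
          using tendstoD[OF lim, of "k/2"] k(1) by (auto simp: eventually_at dist_real_def)
        have "\<bar>f (x + t *\<^sub>R v) - f x - t * y\<bar> \<le> \<bar>t\<bar> * k" if "\<bar>t\<bar> < d" for t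
        proof (cases "t = 0")
          case False
          have "\<bar>(f (x + t *\<^sub>R v) - f x) / t - y\<bar> \<le> k" using d[OF False that] y by linarith
          then have "\<bar>t\<bar> * \<bar>(f (x + t *\<^sub>R v) - f x) / t - y\<bar> \<le> \<bar>t\<bar> * k" by (rule mult_left_mono) simp
          moreover have "f (x + t *\<^sub>R v) - f x - t * y = t * ((f (x + t *\<^sub>R v) - f x) / t - y)"
            using False by (simp add: field_simps)
          ultimately show ?thesis by (simp only: abs_mult)
        qed simp
        then show ?thesis using \<open>d > 0\<close> by blast
      qed
      obtain d1 where d1: "d1 > 0" "\<And>t. \<bar>t\<bar> < d1 \<Longrightarrow> \<bar>f (x + t *\<^sub>R (1, 0)) - f x - t * y\<bar> \<le> \<bar>t\<bar> * k"
        using near[OF a y(2)] by blast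
      obtain d2 where d2: "d2 > 0" "\<And>t. \<bar>t\<bar> < d2 \<Longrightarrow> \<bar>f (x + t *\<^sub>R (0, 1)) - f x - t * z\<bar> \<le> \<bar>t\<bar> * k"
        using near[OF b z(2)] by blast
      obtain m where m: "1 / real (Suc m) < min d1 d2" using d1(1) d2(1) nat_approx_posE by (metis min_less_iff_conj)
      have xA: "x \<in> A y z n m"
        unfolding A_def mem_Collect_eq
      proof (intro allI impI)
        fix t assume "\<bar>t\<bar> \<le> 1 / real (Suc m)"
        then have "\<bar>t\<bar> < d1" "\<bar>t\<bar> < d2" using m by linarith+
        then show "\<bar>f (x + t *\<^sub>R (1, 0)) - f x - t * y\<bar> \<le> \<bar>t\<bar> / real (Suc n) \<and>
            \<bar>f (x + t *\<^sub>R (0, 1)) - f x - t * z\<bar> \<le> \<bar>t\<bar> / real (Suc n)"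
          using d1(2)[of t] d2(2)[of t] by (simp add: k_def)
      qed
      have "x \<in> N" if "x \<in> P y z n m"
        unfolding N_def
        by (rule UnI2, rule UN_I[OF y(1)], rule UN_I[OF z(1)], rule UN_I[OF UNIV_I], rule UN_I[OF UNIV_I], rule that)
      then have "x \<notin> P y z n m" using x by blast
      then have "\<not> (\<forall>d>0. \<exists>r w. 0 < r \<and> r < d \<and> w \<in> cball x r \<and> cball w (k * r) \<inter> A y z n m = {})"
        using xA unfolding P_def k_def by simp
      then obtain d3 where "d3 > 0"
        "\<not> (\<exists>r w. 0 < r \<and> r < d3 \<and> w \<in> cball x r \<and> cball w (k * r) \<inter> A y z n m = {})"
        unfolding not_all not_imp by (elim exE conjE)
      then have d3: "d3 > 0" "\<And>r w. 0 < r \<Longrightarrow> r < d3 \<Longrightarrow> w \<in> cball x r \<Longrightarrow> cball w (k * r) \<inter> A y z n m \<noteq> {}"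
        by blast+
      define d where "d = min d3 (1 / real (Suc m))"
      have "d > 0" using d3(1) by (simp add: d_def)
      have "norm (f w - f x - D (w - x)) \<le> e * norm (w - x)" if w: "norm (w - x) < d" for w
      proof (cases "w = x")
        case False
        define r where "r = norm (w - x)"
        have r: "0 < r" "r < d3" "r < 1 / real (Suc m)" using False w by (auto simp: r_def d_def)
        define s t where "s = fst (w - x)" and "t = snd (w - x)"
        have st: "\<bar>s\<bar> \<le> r" "\<bar>t\<bar> \<le> r"
          using norm_fst_le[of "fst (w - x)" "snd (w - x)"] norm_snd_le[of "snd (w - x)" "fst (w - x)"]
          unfolding s_def t_def r_def prod.collapse real_norm_def by simp_all
        define x1 where "x1 = x + s *\<^sub>R (1, 0)"
        have w_eq: "w = x1 + t *\<^sub>R (0, 1)" by (simp add: x1_def s_def t_def prod_eq_iff)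
        have "x1 \<in> cball x r" using st(1) by (simp add: x1_def dist_norm norm_Pair)
        then have "cball x1 (k * r) \<inter> A y z n m \<noteq> {}" by (rule d3(2)[OF r(1,2)])
        \<comment> \<open>The corner \<open>x1\<close> of the path from \<open>x\<close> to
          \<open>w\<close> need not have controlled partial derivatives. The vertical step is
          therefore made from \<open>x'\<close> and shifted back by the Lipschitz bound.\<close>
        then obtain x' where "x' \<in> A y z n m" "x' \<in> cball x1 (k * r)" by blast
        then have x': "x' \<in> A y z n m" "dist x1 x' \<le> k * r" by simp_all
        have e1: "\<bar>f w - f (x' + t *\<^sub>R (0, 1))\<bar> \<le> L * (k * r)"
        proof -
          have "dist (f w) (f (x' + t *\<^sub>R (0, 1))) \<le> L * dist x1 x'"
            using Lip[of w "x' + t *\<^sub>R (0, 1)"] unfolding w_eq by simp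
          also have "\<dots> \<le> L * (k * r)" using x'(2) L0 by (rule mult_left_mono)
          finally show ?thesis by (simp add: dist_real_def)
        qed
        have e2: "\<bar>f (x' + t *\<^sub>R (0, 1)) - f x' - t * z\<bar> \<le> \<bar>t\<bar> * k"
          using x'(1) st(2) r(3) unfolding A_def k_def by auto
        have e3: "\<bar>f x' - f x1\<bar> \<le> L * (k * r)"
        proof -
          have "dist (f x') (f x1) \<le> L * dist x1 x'" using Lip[of x' x1] by (simp add: dist_commute)
          also have "\<dots> \<le> L * (k * r)" using x'(2) L0 by (rule mult_left_mono)
          finally show ?thesis by (simp add: dist_real_def)
        qed
        have e4: "\<bar>f x1 - f x - s * y\<bar> \<le> \<bar>s\<bar> * k"
          using xA st(1) r(3) unfolding A_def k_def x1_def by auto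
        have e5: "\<bar>s * y - s * a\<bar> \<le> \<bar>s\<bar> * k" "\<bar>t * z - t * b\<bar> \<le> \<bar>t\<bar> * k"
        proof -
          have "\<bar>s * y - s * a\<bar> = \<bar>s\<bar> * \<bar>y - a\<bar>" "\<bar>t * z - t * b\<bar> = \<bar>t\<bar> * \<bar>z - b\<bar>"
            by (simp_all only: right_diff_distrib[symmetric] abs_mult)
          then show "\<bar>s * y - s * a\<bar> \<le> \<bar>s\<bar> * k" "\<bar>t * z - t * b\<bar> \<le> \<bar>t\<bar> * k"
            using y(2) z(2) k(1) by (auto intro!: mult_left_mono)
        qed
        have sk: "\<bar>s\<bar> * k \<le> r * k" "\<bar>t\<bar> * k \<le> r * k" using st k(1) by (simp_all add: mult_right_mono)
        have "\<bar>f w - f x - (s * a + t * b)\<bar> \<le> 2 * (L * (k * r)) + 4 * (r * k)"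
          using e1 e2 e3 e4 e5 sk by linarith
        also have "\<dots> = (2 * L + 4) * k * r" by (simp add: algebra_simps)
        also have "\<dots> \<le> (2 * L + 4) * e' * r" using k(2) L0 r(1) by (intro mult_right_mono mult_left_mono) auto
        also have "(2 * L + 4) * e' = e" using L0 by (simp add: e'_def)
        finally show ?thesis by (simp add: D_def s_def t_def r_def mult.commute)
      qed (simp add: D_def)
      then show "\<exists>d>0. \<forall>w. norm (w - x) < d \<longrightarrow> norm (f w - f x - D (w - x)) \<le> e * norm (w - x)"
        using \<open>d > 0\<close> by blast
    qed
    then show ?thesis by (auto simp: differentiable_def)
  qed
  have "{x. \<not> f differentiable (at x)} \<subseteq> N"
  proof
    fix x assume "x \<in> {x. \<not> f differentiable (at x)}"
    then show "x \<in> N" using diff[of x] by (cases "x \<in> N") simp_all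
  qed
  then show ?thesis by (rule negligible_subset[OF negN])
qed

text \<open>The slicing argument lives on \<open>real \<times> real\<close>. The isometry
  \<open>\<psi>\<close> carries its null sets to \<open>real^2\<close>, and differentiability is
  checked on the two components of \<open>f\<close>.\<close>

theorem Rademacher_vec2:
  fixes f :: "real^2 \<Rightarrow> real^2"
  assumes Lip: "\<And>x y. dist (f x) (f y) \<le> L * dist x y"
  shows "negligible {x. \<not> f differentiable (at x)}"
proof -
  define \<phi> :: "real^2 \<Rightarrow> real \<times> real" where "\<phi> x = (x $ 1, x $ 2)" for x
  define \<psi> :: "real \<times> real \<Rightarrow> real^2" where "\<psi> p = vector [fst p, snd p]" for p
  have psi_phi: "\<psi> (\<phi> x) = x" for x by (simp add: \<phi>_def \<psi>_def vec_eq_iff forall_2)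
  have psi_diff: "\<psi> x - \<psi> y = \<psi> (x - y)" for x y by (simp add: \<psi>_def vec_eq_iff forall_2)
  have norm_psi: "norm (\<psi> p) = norm p" for p
    by (simp add: \<psi>_def norm_vec_def L2_set_def sum_2 norm_prod_def)
  have psi_dist: "dist (\<psi> x) (\<psi> y) \<le> 1 * dist x y" for x y
    by (simp add: dist_norm psi_diff norm_psi)
  have lin: "bounded_linear \<phi>"
    unfolding \<phi>_def by (intro bounded_linear_Pair bounded_linear_vec_nth)
  have L0: "L \<ge> 0"
    using order_trans[OF zero_le_dist Lip[of 0 "axis 1 1"]] by (simp add: dist_norm)
  define g where "g i p = f (\<psi> p) $ i" for i p
  have g_Lip: "dist (g i p) (g i q) \<le> L * dist p q" for i p q
  proof -
    have "dist (g i p) (g i q) \<le> dist (f (\<psi> p)) (f (\<psi> q))" unfolding g_def by (rule dist_vec_nth_le)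
    also have "\<dots> \<le> L * dist (\<psi> p) (\<psi> q)" by (rule Lip)
    also have "\<dots> \<le> L * dist p q" using psi_dist[of p q] L0 by (intro mult_left_mono) auto
    finally show ?thesis .
  qed
  have neg: "negligible (\<psi> ` {p. \<not> g i differentiable (at p)})" for i
    by (rule negligible_Lipschitz_image[OF _ Rademacher_prod[OF g_Lip] psi_dist]) simp
  show ?thesis
  proof (rule negligible_subset[OF negligible_Un[OF neg[of 1] neg[of 2]]], rule subsetI, rule ccontr)
    fix x assume x: "x \<in> {x. \<not> f differentiable (at x)}"
      "x \<notin> \<psi> ` {p. \<not> g 1 differentiable (at p)} \<union> \<psi> ` {p. \<not> g 2 differentiable (at p)}"
    have d: "g i differentiable (at (\<phi> x))" for i
    proof (rule ccontr)
      assume "\<not> g i differentiable (at (\<phi> x))"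
      then have "x \<in> \<psi> ` {p. \<not> g i differentiable (at p)}" by (metis image_eqI mem_Collect_eq psi_phi)
      then show False using x(2) exhaust_2[of i] by auto
    qed
    have "(\<lambda>y. f y $ i) differentiable (at x)" for i
    proof -
      have "\<phi> differentiable (at x)" using lin by (rule bounded_linear_imp_differentiable)
      from differentiable_chain_at[OF this d[of i]] show ?thesis
        by (simp add: comp_def g_def psi_phi)
    qed
    then obtain D where D: "((\<lambda>y. f y $ i) has_derivative D i) (at x)" for i
      unfolding differentiable_def by metis
    have "(f has_derivative (\<lambda>h. \<chi> i. D i h)) (at x)"
      by (subst has_derivative_componentwise_within) (auto simp: Basis_vec_def inner_axis D)
    then have "f differentiable (at x)" by (rule differentiableI)
    then show False using x(1) by simp
  qed
qed

section \<open>The metric\<close>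

text \<open>These are the angles of the normals. The first two give vertical and horizontal lines,
  the future sides of squares; the others run through all rationals and so have directions dense in
  the circle.\<close>

fun line_angle :: "nat \<Rightarrow> real" where
  "line_angle 0 = 0"
| "line_angle (Suc 0) = pi / 2"
| "line_angle (Suc (Suc n)) = of_rat (nat_to_rat_surj n)"

text \<open>The offsets avoid a neighbourhood of the origin that grows with \<open>k\<close>, which makes the whole
  family locally finite.\<close>
definition line :: "nat \<Rightarrow> int \<Rightarrow> (real^2) set" where
  "line k j = {x. x \<bullet> circ (line_angle k) = (of_int j + 1 / 2) * (2 * real k + 1)}"

definition \<Lambda> :: real where "\<Lambda> = 1000"

definition step_cost :: "real^2 \<Rightarrow> real^2 \<Rightarrow> real" where
  "step_cost x y = (if \<exists>k j. x \<in> line k j \<and> y \<in> line k j then 1 else \<Lambda>) * dist x y"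

inductive walk :: "real^2 \<Rightarrow> real^2 \<Rightarrow> real \<Rightarrow> bool" where
  walk_refl: "walk x x 0"
| walk_step: "walk x y C \<Longrightarrow> walk x z (C + step_cost y z)"

definition line_dist :: "real^2 \<Rightarrow> real^2 \<Rightarrow> real" where
  "line_dist x y = Inf {C. walk x y C}"

lemma step_cost_ge_dist: "dist x y \<le> step_cost x y"
  by (auto simp: step_cost_def \<Lambda>_def)

lemma step_cost_le: "step_cost x y \<le> \<Lambda> * dist x y"
  by (auto simp: step_cost_def \<Lambda>_def)

lemma step_cost_commute: "step_cost x y = step_cost y x"
proof -
  have "(\<exists>k j. x \<in> line k j \<and> y \<in> line k j) \<longleftrightarrow> (\<exists>k j. y \<in> line k j \<and> x \<in> line k j)" by blast
  then show ?thesis by (simp add: step_cost_def dist_commute)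
qed

lemma step_cost_line: "x \<in> line k j \<Longrightarrow> y \<in> line k j \<Longrightarrow> step_cost x y = dist x y"
  by (auto simp: step_cost_def)

lemma walk_single: "walk x y (step_cost x y)"
  using walk_step[OF walk_refl] by simp

lemma walk_trans:
  assumes "walk x y C" "walk y z D"
  shows "walk x z (C + D)"
  using assms(2,1)
proof (induction arbitrary: C rule: walk.induct)
  case (walk_step y w D z)
  from walk.walk_step[OF walk_step.IH[OF walk_step.prems], of z] show ?case by (simp add: add.assoc)
qed simp

lemma walk_sym: "walk x y C \<Longrightarrow> walk y x C"
proof (induction rule: walk.induct)
  case (walk_step x y C z)
  from walk_trans[OF walk_single[of z y] walk_step.IH] show ?case
    by (simp add: step_cost_commute add.commute)
qed (rule walk_refl)

lemma walk_ge_dist: "walk x y C \<Longrightarrow> dist x y \<le> C"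
proof (induction rule: walk.induct)
  case (walk_step x y C z)
  then show ?case using dist_triangle[of x z y] step_cost_ge_dist[of y z] by linarith
qed simp

lemma walk_bdd_below: "bdd_below {C. walk x y C}"
  by (rule bdd_belowI[of _ "dist x y"]) (use walk_ge_dist in auto)

lemma line_dist_le_walk: "walk x y C \<Longrightarrow> line_dist x y \<le> C"
  unfolding line_dist_def by (rule cInf_lower[OF _ walk_bdd_below]) simp

lemma line_dist_greatest: "(\<And>C. walk x y C \<Longrightarrow> B \<le> C) \<Longrightarrow> B \<le> line_dist x y"
  unfolding line_dist_def by (rule cInf_greatest) (use walk_single in auto)

lemma walk_almost_line_dist:
  assumes "e > 0"
  obtains C where "walk x y C" "C < line_dist x y + e"
proof -
  have "{C. walk x y C} \<noteq> {}" using walk_single by auto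
  then show ?thesis
    using cInf_lessD[of "{C. walk x y C}" "line_dist x y + e"] assms that
    unfolding line_dist_def by auto
qed

lemma dist_le_line_dist: "dist x y \<le> line_dist x y"
  by (rule line_dist_greatest) (rule walk_ge_dist)

lemma line_dist_le_step_cost: "line_dist x y \<le> step_cost x y"
  by (rule line_dist_le_walk) (rule walk_single)

lemma line_dist_le: "line_dist x y \<le> \<Lambda> * dist x y"
  using line_dist_le_step_cost step_cost_le by (rule order_trans)

lemma line_dist_line: "x \<in> line k j \<Longrightarrow> y \<in> line k j \<Longrightarrow> line_dist x y \<le> dist x y"
  using line_dist_le_step_cost[of x y] by (simp add: step_cost_line)

lemma line_dist_nonneg [simp]: "0 \<le> line_dist x y"
  using zero_le_dist dist_le_line_dist by (rule order_trans)

lemma line_dist_self [simp]: "line_dist x x = 0"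
  using line_dist_le[of x x] line_dist_nonneg[of x x] by simp

lemma line_dist_eq_0: "line_dist x y = 0 \<longleftrightarrow> x = y"
  using dist_le_line_dist[of x y] by auto

lemma line_dist_commute: "line_dist x y = line_dist y x"
proof -
  have "walk x y C \<longleftrightarrow> walk y x C" for C using walk_sym by blast
  then show ?thesis by (simp add: line_dist_def)
qed

lemma line_dist_triangle: "line_dist x z \<le> line_dist x y + line_dist y z"
proof (rule field_le_epsilon)
  fix e :: real assume "e > 0"
  obtain C where C: "walk x y C" "C < line_dist x y + e/2"
    by (rule walk_almost_line_dist[of "e/2"]) (use \<open>e > 0\<close> in auto)
  obtain D where D: "walk y z D" "D < line_dist y z + e/2"
    by (rule walk_almost_line_dist[of "e/2"]) (use \<open>e > 0\<close> in auto)
  from line_dist_le_walk[OF walk_trans[OF C(1) D(1)]] C(2) D(2)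
  show "line_dist x z \<le> line_dist x y + line_dist y z + e" by linarith
qed

lemma is_metric_line_dist: "is_metric line_dist"
  unfolding is_metric_def
  by (simp add: line_dist_eq_0 line_dist_triangle) (metis line_dist_commute)

lemma complete_metric_line_dist: "complete_metric line_dist"
  unfolding complete_metric_def
proof (intro allI impI)
  fix x :: "nat \<Rightarrow> real^2"
  assume *: "\<forall>e>0. \<exists>N. \<forall>m\<ge>N. \<forall>n\<ge>N. line_dist (x m) (x n) < e"
  have "Cauchy x"
    unfolding Cauchy_def by (meson * dist_le_line_dist le_less_trans)
  then obtain l where l: "x \<longlonglongrightarrow> l" using Cauchy_convergent convergent_def by blast
  have "(\<lambda>n. line_dist (x n) l) \<longlonglongrightarrow> 0"
  proof (rule tendsto_sandwich[of "\<lambda>_. 0" _ _ "\<lambda>n. \<Lambda> * dist (x n) l"])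
    show "(\<lambda>n. \<Lambda> * dist (x n) l) \<longlonglongrightarrow> 0"
      using tendsto_mult_right_zero[OF tendsto_dist_iff[THEN iffD1, OF l], of \<Lambda>] .
  qed (auto simp: line_dist_le)
  then show "\<exists>l. (\<lambda>n. line_dist (x n) l) \<longlonglongrightarrow> 0" by blast
qed

lemma bilipschitz_to_R2_line_dist: "bilipschitz_to_R2 line_dist"
  unfolding bilipschitz_to_R2_def
proof (intro exI[of _ id] exI[of _ \<Lambda>] conjI allI)
  fix x y :: "real^2"
  have "line_dist x y \<le> \<Lambda> * line_dist x y" by (simp add: \<Lambda>_def)
  then show "dist x y \<le> \<Lambda> * line_dist (id x) (id y)"
    using dist_le_line_dist[of x y] by simp
qed (simp_all add: \<Lambda>_def line_dist_le[unfolded \<Lambda>_def])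

section \<open>From chains to 1-Lipschitz curves and geodesics\<close>

definition nonexpanding_curve :: "real^2 \<Rightarrow> real^2 \<Rightarrow> real \<Rightarrow> (real \<Rightarrow> real^2) \<Rightarrow> bool" where
  "nonexpanding_curve x y C \<gamma> \<longleftrightarrow> \<gamma> 0 = x \<and> \<gamma> C = y \<and>
     (\<forall>s\<in>{0..C}. \<forall>t\<in>{0..C}. line_dist (\<gamma> s) (\<gamma> t) \<le> \<bar>s - t\<bar>)"

lemma nonexpanding_curveD:
  assumes "nonexpanding_curve x y C \<gamma>" "0 \<le> s" "s \<le> t" "t \<le> C"
  shows "line_dist (\<gamma> s) (\<gamma> t) \<le> t - s"
proof -
  have "\<forall>s\<in>{0..C}. \<forall>t\<in>{0..C}. line_dist (\<gamma> s) (\<gamma> t) \<le> \<bar>s - t\<bar>"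
    using assms(1) unfolding nonexpanding_curve_def by (elim conjE)
  moreover have "s \<in> {0..C}" "t \<in> {0..C}" using assms by simp_all
  ultimately have "line_dist (\<gamma> s) (\<gamma> t) \<le> \<bar>s - t\<bar>" by blast
  then show ?thesis using assms(3) by simp
qed

text \<open>The segment is run at constant speed in time equal to its cost. If the endpoints share a
  line, so do all points of the segment and the time is the Euclidean length; otherwise the time is
  \<Lambda> times that length and the global bound \<open>line_dist_le\<close> suffices.\<close>

lemma nonexpanding_curve_segment: "\<exists>\<gamma>. nonexpanding_curve x y (step_cost x y) \<gamma>"
proof (cases "x = y")
  case True
  then show ?thesis
    by (intro exI[of _ "\<lambda>_. x"]) (simp add: nonexpanding_curve_def)
next
  case False
  define C where "C = step_cost x y"
  have "C > 0" using False step_cost_ge_dist[of x y] zero_less_dist_iff[of x y] unfolding C_def by linarith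
  define \<gamma> where "\<gamma> s = x + (s / C) *\<^sub>R (y - x)" for s
  have dist_\<gamma>: "dist (\<gamma> s) (\<gamma> t) = \<bar>s - t\<bar> / C * dist x y" for s t
  proof -
    have "\<gamma> s - \<gamma> t = ((s - t) / C) *\<^sub>R (y - x)"
      by (simp add: \<gamma>_def scaleR_left_diff_distrib diff_divide_distrib)
    then show ?thesis using \<open>C > 0\<close> by (simp add: dist_norm norm_minus_commute)
  qed
  have "line_dist (\<gamma> s) (\<gamma> t) \<le> \<bar>s - t\<bar>" for s t
  proof (cases "\<exists>k j. x \<in> line k j \<and> y \<in> line k j")
    case True
    then obtain k j where kj: "x \<in> line k j" "y \<in> line k j" by blast
    then have on_line: "\<gamma> u \<in> line k j" for u
      by (simp add: line_def \<gamma>_def inner_add_left inner_diff_left)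
    have "line_dist (\<gamma> s) (\<gamma> t) \<le> dist (\<gamma> s) (\<gamma> t)" by (rule line_dist_line[OF on_line on_line])
    also have "\<dots> = \<bar>s - t\<bar>"
      using dist_\<gamma>[of s t] step_cost_line[OF kj] \<open>C > 0\<close> by (simp add: C_def)
    finally show ?thesis .
  next
    case False
    then have C: "C = \<Lambda> * dist x y" by (simp only: C_def step_cost_def False if_False)
    have "line_dist (\<gamma> s) (\<gamma> t) \<le> \<Lambda> * dist (\<gamma> s) (\<gamma> t)" by (rule line_dist_le)
    also have "\<dots> = \<bar>s - t\<bar> / C * (\<Lambda> * dist x y)" using dist_\<gamma>[of s t] by simp
    also have "\<dots> = \<bar>s - t\<bar>" using \<open>C > 0\<close> unfolding C[symmetric] by simp
    finally show ?thesis .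
  qed
  moreover have "\<gamma> 0 = x" "\<gamma> C = y" using \<open>C > 0\<close> by (simp_all add: \<gamma>_def)
  ultimately show ?thesis unfolding nonexpanding_curve_def C_def[symmetric] by blast
qed

lemma nonexpanding_curve_join:
  assumes "nonexpanding_curve x y C \<gamma>" "nonexpanding_curve y z D \<delta>" "0 \<le> C" "0 \<le> D"
  shows "\<exists>\<eta>. nonexpanding_curve x z (C + D) \<eta>"
proof -
  define \<eta> where "\<eta> t = (if t \<le> C then \<gamma> t else \<delta> (t - C))" for t
  have eta1: "\<eta> t = \<gamma> t" if "t \<le> C" for t using that by (simp add: \<eta>_def)
  have eta2: "\<eta> t = \<delta> (t - C)" if "C \<le> t" for t
    using that assms by (cases "t = C") (simp_all add: \<eta>_def nonexpanding_curve_def)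
  have le: "line_dist (\<eta> s) (\<eta> t) \<le> t - s" if st: "0 \<le> s" "s \<le> t" "t \<le> C + D" for s t
  proof (cases "t \<le> C")
    case True
    then show ?thesis
      using nonexpanding_curveD[OF assms(1) st(1,2)] st eta1[of s] eta1[of t] by simp
  next
    case tC: False
    show ?thesis
    proof (cases "C \<le> s")
      case True
      show ?thesis
        using nonexpanding_curveD[OF assms(2), of "s - C" "t - C"] eta2[of s] eta2[of t] st True by simp
    next
      case False
      have "line_dist (\<gamma> s) (\<gamma> C) \<le> C - s"
        using nonexpanding_curveD[OF assms(1), of s C] st False by simp
      moreover have "line_dist (\<delta> 0) (\<delta> (t - C)) \<le> t - C"
        using nonexpanding_curveD[OF assms(2), of 0 "t - C"] st tC by simp
      moreover have "\<gamma> C = \<delta> 0" using assms(1,2) by (simp add: nonexpanding_curve_def)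
      ultimately show ?thesis
        using line_dist_triangle[of "\<eta> s" "\<eta> t" "\<gamma> C"] eta1[of s] eta2[of t] False tC by simp
    qed
  qed
  have "line_dist (\<eta> s) (\<eta> t) \<le> \<bar>s - t\<bar>" if "s \<in> {0..C + D}" "t \<in> {0..C + D}" for s t
    using le[of s t] le[of t s] that line_dist_commute[of "\<eta> s" "\<eta> t"]
    by (cases "s \<le> t") auto
  moreover have "\<eta> 0 = x" "\<eta> (C + D) = z"
    using eta1[of 0] eta2[of "C + D"] assms by (simp_all add: nonexpanding_curve_def)
  ultimately show ?thesis unfolding nonexpanding_curve_def by blast
qed

lemma walk_nonexpanding_curve: "walk x y C \<Longrightarrow> 0 \<le> C \<and> (\<exists>\<gamma>. nonexpanding_curve x y C \<gamma>)"
proof (induction rule: walk.induct)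
  case (walk_refl x)
  show ?case by (auto simp: nonexpanding_curve_def)
next
  case (walk_step x y C z)
  have "0 \<le> step_cost y z" using step_cost_ge_dist zero_le_dist order_trans by blast
  then show ?case
    using walk_step.IH nonexpanding_curve_segment[of y z] nonexpanding_curve_join by fastforce
qed

text \<open>Nearly optimal chains yield 1-Lipschitz curves; a limit of these is a geodesic by
  Arzela--Ascoli.\<close>
lemma geodesic_metric_line_dist: "geodesic_metric line_dist"
  unfolding geodesic_metric_def
proof (intro allI)
  fix x y :: "real^2"
  define D where "D = line_dist x y"
  have "D \<ge> 0" by (simp add: D_def)
  \<comment> \<open>Arzela-Ascoli needs a common domain, so a curve of length C \<ge> D is cut off
    at time \<open>D\<close>, where it is at most C - D away from \<open>y\<close>.\<close>
  have "\<exists>\<gamma>. \<gamma> 0 = x \<and> line_dist (\<gamma> D) y \<le> 1 / real (Suc n) \<and>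
      (\<forall>s\<in>{0..D}. \<forall>t\<in>{0..D}. line_dist (\<gamma> s) (\<gamma> t) \<le> \<bar>s - t\<bar>)" for n
  proof -
    obtain C where C: "walk x y C" "C < D + 1 / real (Suc n)"
      unfolding D_def by (rule walk_almost_line_dist[of "1 / real (Suc n)"]) auto
    have "D \<le> C" unfolding D_def by (rule line_dist_le_walk[OF C(1)])
    obtain \<gamma> where \<gamma>: "\<gamma> 0 = x" "\<gamma> C = y"
      "\<And>s t. s \<in> {0..C} \<Longrightarrow> t \<in> {0..C} \<Longrightarrow> line_dist (\<gamma> s) (\<gamma> t) \<le> \<bar>s - t\<bar>"
      using walk_nonexpanding_curve[OF C(1)] unfolding nonexpanding_curve_def by blast
    have "line_dist (\<gamma> D) y \<le> \<bar>D - C\<bar>" using \<gamma>(3)[of D C] \<open>D \<le> C\<close> \<open>D \<ge> 0\<close> by (simp add: \<gamma>(2))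
    then show ?thesis using \<gamma> C(2) \<open>D \<le> C\<close> by (intro exI[of _ \<gamma>]) auto
  qed
  then obtain \<gamma> where \<gamma>: "\<And>n. \<gamma> n 0 = x" "\<And>n. line_dist (\<gamma> n D) y \<le> 1 / real (Suc n)"
    "\<And>n s t. s \<in> {0..D} \<Longrightarrow> t \<in> {0..D} \<Longrightarrow> line_dist (\<gamma> n s) (\<gamma> n t) \<le> \<bar>s - t\<bar>"
    by metis
  have \<gamma>_dist: "dist (\<gamma> n s) (\<gamma> n t) \<le> \<bar>s - t\<bar>" if "s \<in> {0..D}" "t \<in> {0..D}" for n s t
    using \<gamma>(3)[OF that] dist_le_line_dist order_trans by blast
  have ArzA: "norm (\<gamma> n s) \<le> norm x + D" if "s \<in> {0..D}" for n s
  proof -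
    have "dist (\<gamma> n s) x \<le> D" using \<gamma>_dist[of s 0 n] that \<open>D \<ge> 0\<close> by (auto simp: \<gamma>(1))
    then show ?thesis using norm_triangle_sub[of "\<gamma> n s" x] by (simp add: dist_norm)
  qed
  obtain g k where g: "continuous_on {0..D} g" "strict_mono (k :: nat \<Rightarrow> nat)"
    "\<And>e. 0 < e \<Longrightarrow> \<exists>N. \<forall>n s. n \<ge> N \<and> s \<in> {0..D} \<longrightarrow> norm (\<gamma> (k n) s - g s) < e"
  proof (rule Arzela_Ascoli[of "{0..D}" \<gamma> "norm x + D"])
    fix s e :: real assume "s \<in> {0..D}" "0 < e"
    then show "\<exists>d>0. \<forall>n t. t \<in> {0..D} \<and> norm (s - t) < d \<longrightarrow> norm (\<gamma> n s - \<gamma> n t) < e"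
      using \<gamma>_dist by (intro exI[of _ e]) (auto simp: dist_norm intro: le_less_trans)
  qed (use ArzA that in auto)
  have lim: "(\<lambda>n. \<gamma> (k n) s) \<longlonglongrightarrow> g s" if "s \<in> {0..D}" for s
    unfolding LIMSEQ_iff using g(3) that by blast
  have ld_lim: "(\<lambda>n. line_dist (\<gamma> (k n) s) (g s)) \<longlonglongrightarrow> 0" if "s \<in> {0..D}" for s
  proof (rule tendsto_sandwich[of "\<lambda>_. 0" _ _ "\<lambda>n. \<Lambda> * dist (\<gamma> (k n) s) (g s)"])
    show "(\<lambda>n. \<Lambda> * dist (\<gamma> (k n) s) (g s)) \<longlonglongrightarrow> 0"
      using tendsto_mult_right_zero[OF tendsto_dist_iff[THEN iffD1, OF lim[OF that]], of \<Lambda>] .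
  qed (auto simp: line_dist_le)
  have le: "line_dist (g s) (g t) \<le> \<bar>s - t\<bar>" if st: "s \<in> {0..D}" "t \<in> {0..D}" for s t
  proof (rule LIMSEQ_le_const)
    show "(\<lambda>n. line_dist (\<gamma> (k n) s) (g s) + (\<bar>s - t\<bar> + line_dist (\<gamma> (k n) t) (g t))) \<longlonglongrightarrow> \<bar>s - t\<bar>"
      using tendsto_add[OF ld_lim[OF st(1)] tendsto_add[OF tendsto_const ld_lim[OF st(2)]], of "\<bar>s - t\<bar>"] by simp
    show "\<exists>N. \<forall>n\<ge>N. line_dist (g s) (g t) \<le> line_dist (\<gamma> (k n) s) (g s) + (\<bar>s - t\<bar> + line_dist (\<gamma> (k n) t) (g t))"
    proof (intro exI allI impI)
      fix n
      show "line_dist (g s) (g t) \<le> line_dist (\<gamma> (k n) s) (g s) + (\<bar>s - t\<bar> + line_dist (\<gamma> (k n) t) (g t))"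
        using line_dist_triangle[of "g s" "g t" "\<gamma> (k n) s"] line_dist_triangle[of "\<gamma> (k n) s" "g t" "\<gamma> (k n) t"]
          \<gamma>(3)[OF st, of "k n"] line_dist_commute[of "g s" "\<gamma> (k n) s"] by linarith
    qed
  qed
  have g0: "g 0 = x"
    using LIMSEQ_unique[OF lim[of 0]] \<open>D \<ge> 0\<close> by (simp add: \<gamma>(1))
  have gD: "g D = y"
  proof (rule LIMSEQ_unique[OF lim[of D]])
    show "(\<lambda>n. \<gamma> (k n) D) \<longlonglongrightarrow> y"
    proof (rule tendsto_dist_iff[THEN iffD2], rule tendsto_sandwich[of "\<lambda>_. 0" _ _ "\<lambda>n. 1 / real (Suc (k n))"])
      show "(\<lambda>n. 1 / real (Suc (k n))) \<longlonglongrightarrow> 0"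
        using LIMSEQ_subseq_LIMSEQ[OF LIMSEQ_inverse_real_of_nat g(2)] unfolding comp_def inverse_eq_divide .
      show "\<forall>\<^sub>F n in sequentially. dist (\<gamma> (k n) D) y \<le> 1 / real (Suc (k n))"
        by (rule always_eventually, rule allI, rule order_trans[OF dist_le_line_dist \<gamma>(2)])
    qed auto
  qed (use \<open>D \<ge> 0\<close> in auto)
  \<comment> \<open>A curve from \<open>x\<close> to \<open>y\<close> that takes time
    \<open>D\<close>, the distance of its ends, cannot shorten any piece: the three pieces would add
    up to less than \<open>D\<close>.\<close>
  have "line_dist (g s) (g t) = t - s" if st: "0 \<le> s" "s \<le> t" "t \<le> D" for s t
  proof -
    have "D = line_dist (g 0) (g D)" unfolding g0 gD by (fact D_def)
    then have "D \<le> line_dist (g 0) (g s) + line_dist (g s) (g t) + line_dist (g t) (g D)"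
      using line_dist_triangle[of "g 0" "g D" "g s"] line_dist_triangle[of "g s" "g D" "g t"]
      by linarith
    then show ?thesis using le[of 0 s] le[of s t] le[of t D] st by simp
  qed
  then have "line_dist (g s) (g t) = \<bar>s - t\<bar>" if "s \<in> {0..D}" "t \<in> {0..D}" for s t
    using that line_dist_commute[of "g s" "g t"] by (cases "s \<le> t") auto
  then show "\<exists>\<gamma>. \<gamma> 0 = x \<and> \<gamma> (line_dist x y) = y \<and>
     (\<forall>s\<in>{0..line_dist x y}. \<forall>t\<in>{0..line_dist x y}. line_dist (\<gamma> s) (\<gamma> t) = \<bar>s - t\<bar>)"
    using g0 gD unfolding D_def by blast
qed

section \<open>Asymptotic cones\<close>

lemma circ_nth [simp]: "circ \<theta> $ 1 = cos \<theta>" "circ \<theta> $ 2 = sin \<theta>"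
  by (simp_all add: circ_def)

lemma inner_vec2: "x \<bullet> y = x $ 1 * y $ 1 + x $ 2 * y $ 2" for x y :: "real^2"
  by (simp add: inner_vec_def sum_2)

lemma norm_circ [simp]: "norm (circ \<theta>) = 1"
  by (simp add: norm_eq_1 inner_vec2 flip: power2_eq_square)

lemma dist_circ_le: "dist (circ a) (circ b) \<le> \<bar>a - b\<bar>"
proof (rule power2_le_imp_le)
  have "(dist (circ a) (circ b))\<^sup>2 = (cos a - cos b)\<^sup>2 + (sin a - sin b)\<^sup>2"
    unfolding dist_norm power2_norm_eq_inner inner_vec2 by (simp add: power2_eq_square)
  also have "\<dots> = ((cos a)\<^sup>2 + (sin a)\<^sup>2) + ((cos b)\<^sup>2 + (sin b)\<^sup>2) - 2 * (cos a * cos b + sin a * sin b)"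
    by (simp only: power2_diff) algebra
  also have "\<dots> = 2 - 2 * cos (a - b)" by (simp add: cos_diff)
  also have "\<dots> = 4 * (sin ((a - b) / 2))\<^sup>2"
  proof -
    have "2 * ((a - b) / 2) = a - b" by simp
    then show ?thesis using cos_double_sin[of "(a - b) / 2"] by (simp only:) simp
  qed
  also have "\<dots> \<le> 4 * ((a - b) / 2)\<^sup>2"
    using abs_sin_x_le_abs_x[of "(a - b) / 2"] by (simp only: abs_le_square_iff mult_le_cancel_left_pos zero_less_numeral)
  also have "\<dots> = \<bar>a - b\<bar>\<^sup>2" by (simp add: power_divide)
  finally show "(dist (circ a) (circ b))\<^sup>2 \<le> \<bar>a - b\<bar>\<^sup>2" .
qed simp

text \<open>The shift by pi/2 turns the normal of a family into its direction; rational angles then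
  approximate any given one.\<close>

lemma line_directions_dense:
  assumes "norm u = 1" "e > 0"
  shows "\<exists>k. dist (circ (line_angle k + pi / 2)) u < e"
proof -
  have "(u $ 1)\<^sup>2 + (u $ 2)\<^sup>2 = 1"
    using assms(1) by (simp add: norm_eq_1 inner_vec2 power2_eq_square)
  then obtain \<phi> where "u $ 1 = cos \<phi>" "u $ 2 = sin \<phi>" using sincos_total_2pi by metis
  then have u: "u = circ \<phi>" by (simp add: vec_eq_iff forall_2)
  obtain q where q: "\<phi> - pi / 2 - e < real_of_rat q" "real_of_rat q < \<phi> - pi / 2 + e"
    using of_rat_dense[of "\<phi> - pi / 2 - e" "\<phi> - pi / 2 + e"] \<open>e > 0\<close> by auto
  obtain n where n: "q = nat_to_rat_surj n" using surj_nat_to_rat_surj by (metis surjD)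
  have "dist (circ (line_angle (Suc (Suc n)) + pi / 2)) u \<le> \<bar>line_angle (Suc (Suc n)) + pi / 2 - \<phi>\<bar>"
    unfolding u by (rule dist_circ_le)
  also have "\<dots> < e" using q n by (simp add: abs_less_iff)
  finally show ?thesis by blast
qed

text \<open>The route goes from \<open>x\<close> perpendicularly to the nearest line of family
  \<open>k\<close>, along it for the length |y - x|, then straight to \<open>y\<close>. Only the
  first and the last leg pay \<Lambda>. Each contains at most half of the spacing 2k+1, and the last
  one also the error caused by the wrong direction.\<close>

lemma line_dist_le_along_line:
  fixes x y :: "real^2"
  defines "u \<equiv> \<lambda>k. circ (line_angle k + pi / 2)"
  shows "line_dist x y \<le> norm (y - x) + \<Lambda> * norm (norm (y - x) *\<^sub>R u k - (y - x)) + \<Lambda> * (2 * real k + 1)"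
proof -
  define n where "n = circ (line_angle k)"
  define W where "W = 2 * real k + 1"
  have "W > 0" by (simp add: W_def)
  \<comment> \<open>The lines of family \<open>k\<close> are the midlines of the strips between j W
    and (j+1) W, so the strip containing \<open>x\<close> has its line within W/2.\<close>
  define j where "j = \<lfloor>(x \<bullet> n) / W\<rfloor>"
  define c where "c = (of_int j + 1 / 2) * W"
  have c: "\<bar>c - x \<bullet> n\<bar> \<le> W / 2"
  proof -
    have "of_int j \<le> (x \<bullet> n) / W" "(x \<bullet> n) / W < of_int j + 1"
      unfolding j_def by linarith+
    then have "of_int j * W \<le> x \<bullet> n" "x \<bullet> n < (of_int j + 1) * W"
      using \<open>W > 0\<close> by (simp_all add: pos_le_divide_eq pos_divide_less_eq)
    moreover have "c = of_int j * W + W / 2" "(of_int j + 1) * W = of_int j * W + W"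
      by (simp_all add: c_def distrib_right)
    ultimately show ?thesis unfolding abs_le_iff by linarith
  qed
  have nn: "n \<bullet> n = 1" unfolding n_def using norm_circ norm_eq_1 by blast
  have un: "u k \<bullet> n = 0" by (simp add: u_def n_def inner_vec2 cos_add sin_add)
  define p where "p = x + (c - x \<bullet> n) *\<^sub>R n"
  define q where "q = p + norm (y - x) *\<^sub>R u k"
  have "p \<in> line k j" "q \<in> line k j"
    using nn un by (simp_all add: line_def p_def q_def c_def W_def inner_add_left flip: n_def)
  then have "line_dist p q \<le> norm (y - x)"
    using line_dist_line[of p k j q] by (simp add: q_def u_def dist_norm)
  moreover have xp: "dist x p \<le> W / 2" using c by (simp add: p_def dist_norm n_def)
  moreover have "dist q y \<le> W / 2 + norm (norm (y - x) *\<^sub>R u k - (y - x))"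
  proof -
    have "norm (p - x) \<le> W / 2" using xp by (simp add: dist_norm norm_minus_commute)
    moreover have qy: "q - y = (p - x) + (norm (y - x) *\<^sub>R u k - (y - x))" by (simp add: q_def)
    ultimately show ?thesis
      using norm_triangle_ineq[of "p - x" "norm (y - x) *\<^sub>R u k - (y - x)"]
      unfolding dist_norm qy by linarith
  qed
  moreover have "line_dist x y \<le> line_dist x p + line_dist p q + line_dist q y"
    using line_dist_triangle[of x y p] line_dist_triangle[of p y q] by linarith
  moreover have "line_dist x p \<le> \<Lambda> * dist x p" "line_dist q y \<le> \<Lambda> * dist q y"
    by (rule line_dist_le)+
  ultimately show ?thesis unfolding \<Lambda>_def W_def by linarith
qed

text \<open>By compactness of the circle finitely many directions approximate all unit vectors
  within e/\<Lambda>; the factor \<Lambda> on the last leg of the route turns this into a relative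
  error \<open>e\<close>. \<open>K\<close> bounds the spacing cost of these finitely many families
  and depends on \<open>e\<close>.\<close>

lemma line_dist_coarsely_euclidean:
  assumes "e > 0"
  shows "\<exists>K. \<forall>x y. line_dist x y \<le> (1 + e) * dist x y + K"
proof -
  define u where "u k = circ (line_angle k + pi / 2)" for k
  define d where "d = e / \<Lambda>"
  have "d > 0" using assms by (simp add: d_def \<Lambda>_def)
  have "sphere 0 1 \<subseteq> (\<Union>k\<in>UNIV. ball (u k) d)"
    using line_directions_dense[OF _ \<open>d > 0\<close>] by (force simp: u_def)
  then obtain I where I: "finite I" "sphere 0 1 \<subseteq> (\<Union>k\<in>I. ball (u k) d)"
    using compactE_image[OF compact_sphere, of UNIV "\<lambda>k. ball (u k) d"] by (metis open_ball)
  define K where "K = \<Lambda> * (\<Sum>k\<in>I. 2 * real k + 1)"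
  have "line_dist x y \<le> (1 + e) * dist x y + K" for x y
  proof (cases "x = y")
    case True
    then show ?thesis by (simp add: K_def \<Lambda>_def sum_nonneg)
  next
    case False
    define r where "r = norm (y - x)"
    have "r > 0" using False by (simp add: r_def)
    have "(1 / r) *\<^sub>R (y - x) \<in> sphere 0 1" using \<open>r > 0\<close> by (simp add: r_def)
    then have "(1 / r) *\<^sub>R (y - x) \<in> (\<Union>k\<in>I. ball (u k) d)" by (rule subsetD[OF I(2)])
    then obtain k where k: "k \<in> I" "dist (u k) ((1 / r) *\<^sub>R (y - x)) < d"
      unfolding UN_iff mem_ball by (elim bexE)
    have "r *\<^sub>R u k - (y - x) = r *\<^sub>R (u k - (1 / r) *\<^sub>R (y - x))"
      using \<open>r > 0\<close> by (simp add: scaleR_right_diff_distrib)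
    then have "norm (r *\<^sub>R u k - (y - x)) = r * dist (u k) ((1 / r) *\<^sub>R (y - x))"
      using \<open>r > 0\<close> by (simp add: dist_norm)
    also have "\<dots> \<le> r * d" using k(2) \<open>r > 0\<close> by (intro mult_left_mono) auto
    finally have "\<Lambda> * norm (r *\<^sub>R u k - (y - x)) \<le> e * r"
      by (simp add: d_def \<Lambda>_def mult.commute)
    moreover have "\<Lambda> * (2 * real k + 1) \<le> K"
      unfolding K_def using I(1) k(1)
      by (intro mult_left_mono member_le_sum[of k I "\<lambda>k. 2 * real k + 1"]) (auto simp: \<Lambda>_def)
    moreover have "dist x y = r" by (simp add: r_def dist_norm norm_minus_commute)
    ultimately show ?thesis
      using line_dist_le_along_line[of x y k] by (simp add: u_def r_def distrib_right)
  qed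
  then show ?thesis by blast
qed

text \<open>Compactness gives a cluster point, and for an ultrafilter a cluster point is a limit: if
  the sequence were not eventually in a neighbourhood, it would eventually be outside it.\<close>

lemma ultrafilter_bounded_convergent:
  fixes z :: "nat \<Rightarrow> 'a::{real_normed_vector,heine_borel}"
  assumes \<omega>: "\<omega> \<noteq> bot" "\<And>P. eventually P \<omega> \<or> eventually (\<lambda>n. \<not> P n) \<omega>"
    and z: "\<And>n. norm (z n) \<le> M"
  shows "\<exists>l. (z \<longlongrightarrow> l) \<omega>"
proof -
  have "compact (cball (0::'a) M)" by simp
  moreover have "filtermap z \<omega> \<noteq> bot" using \<omega>(1) by (simp add: filtermap_bot_iff)
  moreover have "eventually (\<lambda>w. w \<in> cball 0 M) (filtermap z \<omega>)"
    using z by (simp add: eventually_filtermap)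
  ultimately obtain l where l: "inf (nhds l) (filtermap z \<omega>) \<noteq> bot"
    unfolding compact_filter by blast
  have "(z \<longlongrightarrow> l) \<omega>"
  proof (rule topological_tendstoI)
    fix S assume S: "open S" "l \<in> S"
    show "eventually (\<lambda>n. z n \<in> S) \<omega>"
    proof (rule ccontr)
      assume "\<not> eventually (\<lambda>n. z n \<in> S) \<omega>"
      then have "eventually (\<lambda>n. z n \<notin> S) \<omega>" using \<omega>(2)[of "\<lambda>n. z n \<in> S"] by blast
      then have "eventually (\<lambda>w. w \<notin> S) (filtermap z \<omega>)" by (simp add: eventually_filtermap)
      moreover have "eventually (\<lambda>w. w \<in> S) (nhds l)" using S by (rule eventually_nhds_in_open)
      ultimately have "eventually (\<lambda>w. False) (inf (nhds l) (filtermap z \<omega>))"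
        unfolding eventually_inf by blast
      then show False using l by (simp add: eventually_False)
    qed
  qed
  then show ?thesis by blast
qed

text \<open>A point of the cone is sent to the ultralimit of its rescaled Euclidean displacements
  from the base points, which are bounded because \<open>dist\<close> is below
  \<open>line_dist\<close>. It remains to see that the two rescaled distances have the same
  limit.\<close>

lemma asymptotic_cones_line_dist: "all_asymptotic_cones_euclidean_plane line_dist"
  unfolding all_asymptotic_cones_euclidean_plane_def Let_def
proof (intro allI impI, elim conjE)
  fix \<omega> :: "nat filter" and p :: "nat \<Rightarrow> real^2" and t :: "nat \<Rightarrow> real"
  assume \<omega>: "nonprincipal_ultrafilter \<omega>" and t_pos: "\<forall>n. 0 < t n" and t0: "t \<longlonglongrightarrow> 0"
  define B where "B = {x :: nat \<Rightarrow> real^2. \<exists>C. \<forall>n. t n * line_dist (x n) (p n) \<le> C}"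
  define z where "z x n = t n *\<^sub>R (x n - p n)" for x n
  have \<omega>': "\<omega> \<noteq> bot" "\<And>P. eventually P \<omega> \<or> eventually (\<lambda>n. \<not> P n) \<omega>" "\<omega> \<le> sequentially"
    using \<omega> by (simp_all add: nonprincipal_ultrafilter_def cofinite_eq_sequentially)
  have z_bdd: "\<exists>C. \<forall>n. norm (z x n) \<le> C" if x: "x \<in> B" for x
  proof -
    obtain C where C: "\<And>n. t n * line_dist (x n) (p n) \<le> C" using x unfolding B_def by blast
    have "norm (z x n) \<le> C" for n
    proof -
      have "norm (z x n) = t n * dist (x n) (p n)" using t_pos by (simp add: z_def dist_norm less_imp_le)
      also have "\<dots> \<le> t n * line_dist (x n) (p n)"
        using t_pos dist_le_line_dist by (simp add: mult_left_mono less_imp_le)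
      finally show ?thesis using C order_trans by blast
    qed
    then show ?thesis by blast
  qed
  have z_conv: "\<exists>l. (z x \<longlongrightarrow> l) \<omega>" if x: "x \<in> B" for x
  proof -
    obtain C where "\<forall>n. norm (z x n) \<le> C" using z_bdd[OF x] by blast
    then show ?thesis by (intro ultrafilter_bounded_convergent[OF \<omega>'(1,2)]) auto
  qed
  define f where "f x = (SOME l. (z x \<longlongrightarrow> l) \<omega>)" for x
  have f: "(z x \<longlongrightarrow> f x) \<omega>" if "x \<in> B" for x
    unfolding f_def using z_conv[OF that] by (rule someI_ex)
  have surj: "v \<in> f ` B" for v
  proof -
    define x where "x n = p n + (1 / t n) *\<^sub>R v" for n
    have zx: "z x = (\<lambda>n. v)"
    proof
      fix n show "z x n = v" using t_pos[rule_format, of n] by (simp add: z_def x_def)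
    qed
    have "t n * line_dist (x n) (p n) \<le> \<Lambda> * norm v" for n
    proof -
      have tn: "0 < t n" using t_pos by blast
      have "t n * line_dist (x n) (p n) \<le> t n * (\<Lambda> * dist (x n) (p n))"
        using tn line_dist_le by (intro mult_left_mono) auto
      also have "\<dots> = \<Lambda> * norm v" using tn by (simp add: x_def dist_norm)
      finally show ?thesis .
    qed
    then have "x \<in> B" unfolding B_def by blast
    moreover have "f x = v"
      using tendsto_unique[OF \<omega>'(1) f[OF \<open>x \<in> B\<close>]] unfolding zx by simp
    ultimately show ?thesis by blast
  qed
  have isom: "((\<lambda>n. t n * line_dist (x n) (y n)) \<longlongrightarrow> dist (f x) (f y)) \<omega>" if x: "x \<in> B" and y: "y \<in> B" for x y
  proof -
    have tdist: "t n * dist (x n) (y n) = dist (z x n) (z y n)" for n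
    proof -
      have "z x n - z y n = t n *\<^sub>R (x n - y n)" by (simp add: z_def scaleR_right_diff_distrib)
      then show ?thesis using t_pos[rule_format, of n] by (simp add: dist_norm)
    qed
    obtain C where C: "\<And>n. norm (z x n) \<le> C" using z_bdd[OF x] by blast
    obtain D where D: "\<And>n. norm (z y n) \<le> D" using z_bdd[OF y] by blast
    have bd: "t n * dist (x n) (y n) \<le> C + D" for n
      unfolding tdist unfolding dist_norm using norm_triangle_ineq4[of "z x n" "z y n"] C[of n] D[of n] by linarith
    have CD: "C + D \<ge> 0" using C[of 0] D[of 0] norm_ge_zero[of "z x 0"] norm_ge_zero[of "z y 0"] by linarith
    have "(\<lambda>n. t n * line_dist (x n) (y n) - t n * dist (x n) (y n)) \<longlonglongrightarrow> 0"
    proof (rule LIMSEQ_I)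
      fix e :: real assume "e > 0"
      \<comment> \<open>Rescaled Euclidean distances are at most C + D, so the relative error
        \<open>d\<close> contributes at most e/2. Once \<open>d\<close> is fixed, so is the additive
        constant \<open>K\<close>, and t K tends to 0.\<close>
      define d where "d = e / (2 * (C + D + 1))"
      have "d > 0" using \<open>e > 0\<close> CD by (simp add: d_def)
      obtain K where K: "\<And>x y. line_dist x y \<le> (1 + d) * dist x y + K"
        using line_dist_coarsely_euclidean[OF \<open>d > 0\<close>] by blast
      have "(\<lambda>n. t n * \<bar>K\<bar>) \<longlonglongrightarrow> 0" using tendsto_mult_left_zero[OF t0] .
      then obtain N where N: "\<And>n. n \<ge> N \<Longrightarrow> norm (t n * \<bar>K\<bar> - 0) < e / 2"
        using LIMSEQ_D[of "\<lambda>n. t n * \<bar>K\<bar>" 0 "e / 2"] \<open>e > 0\<close> by auto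
      have "norm (t n * line_dist (x n) (y n) - t n * dist (x n) (y n) - 0) < e" if "n \<ge> N" for n
      proof -
        have tn: "0 < t n" using t_pos by blast
        have ge: "t n * dist (x n) (y n) \<le> t n * line_dist (x n) (y n)"
          using tn dist_le_line_dist by (intro mult_left_mono) auto
        have "t n * line_dist (x n) (y n) \<le> t n * ((1 + d) * dist (x n) (y n) + \<bar>K\<bar>)"
          using tn K[of "x n" "y n"] by (intro mult_left_mono) auto
        also have "\<dots> = t n * dist (x n) (y n) + d * (t n * dist (x n) (y n)) + t n * \<bar>K\<bar>"
          by (simp add: algebra_simps)
        finally have "t n * line_dist (x n) (y n) - t n * dist (x n) (y n) \<le>
            d * (t n * dist (x n) (y n)) + t n * \<bar>K\<bar>" by simp
        moreover have "d * (t n * dist (x n) (y n)) \<le> d * (C + D + 1)"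
          using bd[of n] \<open>d > 0\<close> by (intro mult_left_mono) auto
        moreover have "d * (C + D + 1) = e / 2"
        proof -
          have "C + D + 1 \<noteq> 0" using CD by linarith
          then show ?thesis by (simp add: d_def field_simps)
        qed
        moreover have "t n * \<bar>K\<bar> < e / 2" using N[OF that] tn by simp
        ultimately show ?thesis using ge by simp
      qed
      then show "\<exists>N. \<forall>n\<ge>N. norm (t n * line_dist (x n) (y n) - t n * dist (x n) (y n) - 0) < e" by blast
    qed
    then have "((\<lambda>n. t n * line_dist (x n) (y n) - t n * dist (x n) (y n)) \<longlongrightarrow> 0) \<omega>"
      by (rule tendsto_mono[OF \<omega>'(3)])
    moreover have "((\<lambda>n. t n * dist (x n) (y n)) \<longlongrightarrow> dist (f x) (f y)) \<omega>"
      unfolding tdist by (rule tendsto_dist[OF f[OF x] f[OF y]])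
    ultimately show ?thesis using tendsto_add by fastforce
  qed
  show "\<exists>f :: (nat \<Rightarrow> real^2) \<Rightarrow> real^2. f ` {x. \<exists>C. \<forall>n. t n * line_dist (x n) (p n) \<le> C} = UNIV \<and>
      (\<forall>x\<in>{x. \<exists>C. \<forall>n. t n * line_dist (x n) (p n) \<le> C}.
        \<forall>y\<in>{x. \<exists>C. \<forall>n. t n * line_dist (x n) (p n) \<le> C}.
          ((\<lambda>n. t n * line_dist (x n) (y n)) \<longlongrightarrow> dist (f x) (f y)) \<omega>)"
    unfolding B_def[symmetric]
  proof (intro exI[of _ f] conjI ballI isom)
    show "f ` B = UNIV" using surj by blast
  qed
qed

section \<open>Metric derivatives and Jacobians\<close>

definition lines :: "(real^2) set" where
  "lines = (\<Union>k j. line k j)"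

lemma closed_line: "closed (line k j)"
  unfolding line_def by (intro closed_Collect_eq continuous_intros)

lemma negligible_lines: "negligible lines"
proof -
  have "negligible (line k j)" for k j
  proof -
    have "circ (line_angle k) \<noteq> 0" using norm_circ[of "line_angle k"] by (metis norm_zero zero_neq_one)
    then show ?thesis
      using negligible_hyperplane[of "circ (line_angle k)" "(of_int j + 1 / 2) * (2 * real k + 1)"]
      by (simp add: line_def inner_commute)
  qed
  then show ?thesis unfolding lines_def
    by (intro negligible_countable_Union) auto
qed

lemma borel_lines: "lines \<in> sets borel"
  unfolding lines_def by (intro sets.countable_UN'' countableI_type borel_closed closed_line)

text \<open>The line with indices k, j is at distance |j + 1/2| (2k + 1) from the origin. This is at
  least k + 1/2 and at least |j + 1/2|, so only finitely many lines meet the unit ball around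
  \<open>p\<close>, and their union is closed.\<close>

lemma ball_avoiding_lines:
  assumes "p \<notin> lines"
  obtains R where "R > 0" "ball p R \<inter> lines = {}"
proof -
  define M where "M = norm p + 1"
  define I where "I = {(k, j). line k j \<inter> cball p 1 \<noteq> {}}"
  have "I \<subseteq> {..nat \<lceil>M\<rceil>} \<times> {- \<lceil>M + 1\<rceil>..\<lceil>M + 1\<rceil>}"
  proof safe
    fix k j assume "(k, j) \<in> I"
    then obtain x where x: "x \<in> line k j" "dist p x \<le> 1" by (auto simp: I_def)
    have "norm x \<le> M" using norm_triangle_sub[of x p] x(2) by (simp add: M_def dist_norm norm_minus_commute)
    then have "\<bar>x \<bullet> circ (line_angle k)\<bar> \<le> M"
      using Cauchy_Schwarz_ineq2[of x "circ (line_angle k)"] by simp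
    then have *: "\<bar>of_int j + 1 / 2\<bar> * (2 * real k + 1) \<le> M"
      using x(1) by (simp add: line_def abs_mult)
    have half: "1 / 2 \<le> \<bar>of_int j + 1 / 2 :: real\<bar>"
    proof (cases "j \<ge> 0")
      case False
      then have "of_int j \<le> (-1 :: real)" by linarith
      then show ?thesis by linarith
    qed simp
    have "1 / 2 * (2 * real k + 1) \<le> \<bar>of_int j + 1 / 2\<bar> * (2 * real k + 1)"
      by (rule mult_right_mono[OF half]) simp
    also note *
    finally have "real k \<le> M" by simp
    then show "k \<le> nat \<lceil>M\<rceil>" by linarith
    have "\<bar>of_int j + 1 / 2 :: real\<bar> * 1 \<le> \<bar>of_int j + 1 / 2\<bar> * (2 * real k + 1)"
      by (rule mult_left_mono) auto
    also note *
    finally have "\<bar>of_int j + 1 / 2 :: real\<bar> \<le> M" by simp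
    then have "\<bar>of_int j :: real\<bar> \<le> M + 1" by linarith
    then show "j \<in> {- \<lceil>M + 1\<rceil>..\<lceil>M + 1\<rceil>}" by (simp add: abs_le_iff) linarith
  qed
  then have "finite I" by (rule finite_subset) simp
  then have "closed (\<Union>(k, j)\<in>I. line k j)" using closed_line by (intro closed_UN) auto
  then have "open (- (\<Union>(k, j)\<in>I. line k j))" by (rule open_Compl)
  moreover have "p \<in> - (\<Union>(k, j)\<in>I. line k j)" using assms by (auto simp: lines_def)
  ultimately obtain R where R: "R > 0" "ball p R \<subseteq> - (\<Union>(k, j)\<in>I. line k j)"
    by (rule openE)
  have "x \<notin> lines" if x: "x \<in> ball p (min R 1)" for x
  proof
    assume "x \<in> lines"
    then obtain k j where kj: "x \<in> line k j" by (auto simp: lines_def)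
    then have "(k, j) \<in> I" using x by (auto simp: I_def)
    then have "x \<in> (\<Union>(k, j)\<in>I. line k j)" using kj by (intro UN_I[of "(k, j)"]) simp_all
    moreover have "x \<in> - (\<Union>(k, j)\<in>I. line k j)" by (rule subsetD[OF R(2)]) (use x in simp)
    ultimately show False unfolding Compl_iff by contradiction
  qed
  then show ?thesis using R(1) by (intro that[of "min R 1"]) auto
qed

text \<open>A cheap step starts on a line, hence outside the ball, and a chain has already spent
  \<Lambda> R when it first reaches such a point. The minimum is the invariant that survives both
  kinds of step.\<close>

lemma walk_ge_local:
  assumes "walk p q C" "ball p R \<inter> lines = {}"
  shows "min (\<Lambda> * dist p q) (\<Lambda> * R) \<le> C"
  using assms
proof (induction rule: walk.induct)
  case (walk_refl x)
  then show ?case by simp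
next
  case (walk_step x y C z)
  then have IH: "min (\<Lambda> * dist x y) (\<Lambda> * R) \<le> C" by blast
  show ?case
  proof (cases "\<exists>k j. y \<in> line k j \<and> z \<in> line k j")
    case True
    then have "y \<in> lines" by (auto simp: lines_def)
    then have "y \<notin> ball x R" using walk_step.prems by blast
    then have "\<Lambda> * R \<le> \<Lambda> * dist x y" by (simp add: \<Lambda>_def)
    then have "\<Lambda> * R \<le> C" using IH by simp
    moreover have "0 \<le> step_cost y z" using step_cost_ge_dist zero_le_dist order_trans by blast
    ultimately show ?thesis by simp
  next
    case False
    then have "step_cost y z = \<Lambda> * dist y z" by (simp only: step_cost_def if_False)
    moreover have "\<Lambda> * dist x z \<le> \<Lambda> * dist x y + \<Lambda> * dist y z"
      using dist_triangle[of x z y] by (simp add: \<Lambda>_def)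
    moreover have "0 \<le> \<Lambda> * dist y z" by (simp add: \<Lambda>_def)
    ultimately show ?thesis using IH by linarith
  qed
qed

lemma line_dist_local:
  assumes "ball p R \<inter> lines = {}" "dist p q \<le> R"
  shows "line_dist p q = \<Lambda> * dist p q"
proof (rule antisym[OF line_dist_le line_dist_greatest])
  fix C assume "walk p q C"
  from walk_ge_local[OF this assms(1)] show "\<Lambda> * dist p q \<le> C"
    using assms(2) by (simp add: \<Lambda>_def min_absorb1)
qed

text \<open>Along z + h/(n+1) homogeneity makes the difference of the two quotients the constant (s2
  h - s1 h)/|h|, which must then be its limit 0. This justifies the definite description in
  \<open>md\<close>.\<close>

lemma is_metric_derivative_unique:
  assumes "is_metric_derivative d v z s1" "is_metric_derivative d v z s2"
  shows "s1 = s2"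
proof
  fix h
  have hom: "s (c *\<^sub>R x) = \<bar>c\<bar> * s x" if "is_metric_derivative d v z s" for s c x
    using that by (simp add: is_metric_derivative_def seminorm2_def)
  show "s1 h = s2 h"
  proof (cases "h = 0")
    case True
    then show ?thesis using hom[OF assms(1), of 0 0] hom[OF assms(2), of 0 0] by simp
  next
    case False
    define g where "g n = z + (1 / real (Suc n)) *\<^sub>R h" for n
    have "g \<longlonglongrightarrow> z + 0 *\<^sub>R h"
      unfolding g_def
      by (intro tendsto_intros LIMSEQ_inverse_real_of_nat[unfolded inverse_eq_divide])
    moreover have "g n \<noteq> z" for n using False by (simp add: g_def)
    ultimately have g: "filterlim g (at z) sequentially" by (simp add: filterlim_at)
    have "((\<lambda>z'. (d (v z') (v z) - s1 (z' - z)) / norm (z' - z) - (d (v z') (v z) - s2 (z' - z)) / norm (z' - z)) \<longlongrightarrow> 0 - 0) (at z)"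
      using assms unfolding is_metric_derivative_def by (intro tendsto_diff) auto
    from filterlim_compose[OF this g]
    have "(\<lambda>n. (d (v (g n)) (v z) - s1 (g n - z)) / norm (g n - z) - (d (v (g n)) (v z) - s2 (g n - z)) / norm (g n - z)) \<longlonglongrightarrow> 0"
      by simp
    moreover have "(d (v (g n)) (v z) - s1 (g n - z)) / norm (g n - z) - (d (v (g n)) (v z) - s2 (g n - z)) / norm (g n - z)
        = (s2 h - s1 h) / norm h" for n
    proof -
      define m where "m = real (Suc n)"
      have "m > 0" by (simp add: m_def)
      have gz: "g n - z = (1 / m) *\<^sub>R h" by (simp add: g_def m_def)
      have eqs: "s1 (g n - z) = s1 h / m" "s2 (g n - z) = s2 h / m" "norm (g n - z) = norm h / m"
        unfolding gz using hom[OF assms(1)] hom[OF assms(2)] \<open>m > 0\<close> by simp_all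
      have "(d (v (g n)) (v z) - s1 (g n - z)) / norm (g n - z) - (d (v (g n)) (v z) - s2 (g n - z)) / norm (g n - z)
         = (s2 (g n - z) - s1 (g n - z)) / norm (g n - z)"
        unfolding diff_divide_distrib[symmetric] by simp
      also have "\<dots> = ((s2 h - s1 h) / m) / (norm h / m)"
        unfolding eqs diff_divide_distrib[symmetric] ..
      also have "\<dots> = (s2 h - s1 h) / norm h" using \<open>m > 0\<close> by simp
      finally show ?thesis .
    qed
    ultimately have "(\<lambda>n::nat. (s2 h - s1 h) / norm h) \<longlonglongrightarrow> 0" by simp
    then show ?thesis using False by (simp add: tendsto_const_iff)
  qed
qed

lemma md_eqI: "is_metric_derivative d v z s \<Longrightarrow> md d v z = s"
  unfolding md_def by (rule the_equality) (auto intro: is_metric_derivative_unique)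

text \<open>A metric derivative at \<open>z\<close> sees only distances to \<open>v z\<close>, and
  near that point these are exactly \<Lambda> times Euclidean. The rest is the definition of the
  differential.\<close>

lemma md_line_dist:
  assumes v: "(v has_derivative f') (at z)" and "v z \<notin> lines"
  shows "md line_dist v z = (\<lambda>h. \<Lambda> * norm (f' h))"
proof (rule md_eqI)
  have lin: "linear f'" using v has_derivative_linear by blast
  have "seminorm2 (\<lambda>h. \<Lambda> * norm (f' h))"
    unfolding seminorm2_def
  proof (intro conjI allI)
    fix x y c
    have "norm (f' (x + y)) \<le> norm (f' x) + norm (f' y)"
      using linear_add[OF lin] norm_triangle_ineq by metis
    then show "\<Lambda> * norm (f' (x + y)) \<le> \<Lambda> * norm (f' x) + \<Lambda> * norm (f' y)" by (simp add: \<Lambda>_def)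
    show "\<Lambda> * norm (f' (c *\<^sub>R x)) = \<bar>c\<bar> * (\<Lambda> * norm (f' x))"
      using linear_cmul[OF lin, of c x] by simp
  qed
  moreover have "((\<lambda>z'. (line_dist (v z') (v z) - \<Lambda> * norm (f' (z' - z))) / norm (z' - z)) \<longlongrightarrow> 0) (at z)"
  proof (rule Lim_null_comparison)
    obtain R where R: "R > 0" "ball (v z) R \<inter> lines = {}" using ball_avoiding_lines[OF assms(2)] by blast
    have "(v \<longlongrightarrow> v z) (at z)" using has_derivative_continuous[OF v] by (simp add: continuous_at)
    then have "\<forall>\<^sub>F z' in at z. dist (v z') (v z) < R" using R(1) by (rule tendstoD)
    then show "\<forall>\<^sub>F z' in at z. norm ((line_dist (v z') (v z) - \<Lambda> * norm (f' (z' - z))) / norm (z' - z))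
        \<le> \<Lambda> * (norm ((v z' - v z) - f' (z' - z)) / norm (z' - z))"
    proof eventually_elim
      case (elim z')
      then have ld: "line_dist (v z') (v z) = \<Lambda> * norm (v z' - v z)"
        using line_dist_local[OF R(2), of "v z'"]
        by (simp add: dist_commute line_dist_commute[of "v z'"] flip: dist_norm)
      have "\<bar>line_dist (v z') (v z) - \<Lambda> * norm (f' (z' - z))\<bar> = \<Lambda> * \<bar>norm (v z' - v z) - norm (f' (z' - z))\<bar>"
        unfolding ld right_diff_distrib[symmetric] abs_mult by (simp add: \<Lambda>_def)
      also have "\<dots> \<le> \<Lambda> * norm ((v z' - v z) - f' (z' - z))"
        using norm_triangle_ineq3 by (intro mult_left_mono) (auto simp: \<Lambda>_def)
      finally have "\<bar>line_dist (v z') (v z) - \<Lambda> * norm (f' (z' - z))\<bar> / norm (z' - z)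
          \<le> \<Lambda> * norm ((v z' - v z) - f' (z' - z)) / norm (z' - z)"
        by (rule divide_right_mono) simp
      then show ?case by simp
    qed
    show "((\<lambda>z'. \<Lambda> * (norm ((v z' - v z) - f' (z' - z)) / norm (z' - z))) \<longlongrightarrow> 0) (at z)"
      using v unfolding has_derivative_iff_norm by (intro tendsto_mult_right_zero) auto
  qed
  ultimately show "is_metric_derivative line_dist v z (\<lambda>h. \<Lambda> * norm (f' h))"
    unfolding is_metric_derivative_def by blast
qed

text \<open>A covering set of diameter r lies in a ball of radius r about any of its points, so the
  images under \<open>T\<close> cover the parallelogram by discs of area pi r^2/c^2. The radius r
  instead of r/2 avoids the isodiametric inequality at the price of the factor 1/4. The scale
  \<delta> = 1 already gives the bound.\<close>

lemma hausdorff2_unit_square_ge: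
  fixes T :: "real^2 \<Rightarrow> real^2"
  assumes T: "linear T" and "c > 0"
  shows "ennreal (c\<^sup>2 / 4 * \<bar>det (matrix T)\<bar>) \<le> hausdorff2 (\<lambda>x y. c * norm (T (x - y))) unit_square"
proof -
  define s where "s = (\<lambda>x y. c * norm (T (x - y)))"
  have sq: "unit_square = cbox 0 1"
    by (auto simp: unit_square_def mem_box_cart)
  have "ennreal (c\<^sup>2 / 4 * \<bar>det (matrix T)\<bar>) \<le> (\<Sum>i. ennreal (pi / 4) * (ddiam s (C i))\<^sup>2)"
    if cov: "unit_square \<subseteq> (\<Union>i. C i)" and fin: "\<And>i. ddiam s (C i) < ennreal 1" for C :: "nat \<Rightarrow> (real^2) set"
  proof -
    define r where "r i = enn2real (ddiam s (C i))" for i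
    have r: "ddiam s (C i) = ennreal (r i)" for i
      unfolding r_def by (rule ennreal_enn2real[symmetric], rule order.strict_trans[OF fin ennreal_less_top])
    have r0: "r i \<ge> 0" for i by (simp add: r_def)
    \<comment> \<open>For an empty \<open>C i\<close> the centre is arbitrary; its disc merely
      enlarges the cover.\<close>
    define a where "a i = (SOME x. x \<in> C i)" for i
    have sub: "T ` unit_square \<subseteq> (\<Union>i. cball (T (a i)) (r i / c))"
    proof
      fix y assume "y \<in> T ` unit_square"
      then obtain x i where x: "y = T x" "x \<in> C i" using cov by blast
      then have "a i \<in> C i" unfolding a_def by (metis someI)
      have "ennreal (s (a i) x) \<le> ddiam s (C i)"
        unfolding ddiam_def using \<open>a i \<in> C i\<close> x(2) by (meson SUP_upper2 order_refl)
      then have "s (a i) x \<le> r i" using r r0 by (simp add: ennreal_le_iff)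
      then have "norm (T (a i) - T x) \<le> r i / c"
        using \<open>c > 0\<close> linear_diff[OF T] by (simp add: s_def pos_le_divide_eq mult.commute)
      then show "y \<in> (\<Union>i. cball (T (a i)) (r i / c))" using x(1) by (auto simp: dist_norm)
    qed
    have "0 \<in> cbox 0 (1 :: real^2)" by (simp add: mem_box_cart)
    then have ne: "cbox 0 (1 :: real^2) \<noteq> {}" by blast
    have Tm: "T ` unit_square \<in> lmeasurable" "measure lebesgue (T ` unit_square) = \<bar>det (matrix T)\<bar>"
      unfolding sq using measurable_linear_image[OF T, of "cbox 0 1"] measure_linear_image[OF T, of "cbox 0 1"]
      by (simp_all add: content_cbox_cart[OF ne])
    have "ennreal \<bar>det (matrix T)\<bar> = emeasure lebesgue (T ` unit_square)"
      using Tm by (simp add: emeasure_eq_measure2)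
    also have "\<dots> \<le> emeasure lebesgue (\<Union>i. cball (T (a i)) (r i / c))"
      by (intro emeasure_mono[OF sub] sets.countable_UN) auto
    also have "\<dots> \<le> (\<Sum>i. emeasure lebesgue (cball (T (a i)) (r i / c)))"
      by (rule emeasure_subadditive_countably) auto
    also have "\<dots> = (\<Sum>i. ennreal (pi / c\<^sup>2 * (r i)\<^sup>2))"
    proof (rule suminf_cong)
      fix i
      have "0 \<le> r i / c" using r0 \<open>c > 0\<close> by simp
      then show "emeasure lebesgue (cball (T (a i)) (r i / c)) = ennreal (pi / c\<^sup>2 * (r i)\<^sup>2)"
        by (simp add: emeasure_cball unit_ball_vol_2 power_divide)
    qed
    finally have "ennreal (c\<^sup>2 / 4) * ennreal \<bar>det (matrix T)\<bar> \<le> ennreal (c\<^sup>2 / 4) * (\<Sum>i. ennreal (pi / c\<^sup>2 * (r i)\<^sup>2))"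
      by (rule mult_left_mono) simp
    also have "\<dots> = (\<Sum>i. ennreal (c\<^sup>2 / 4) * ennreal (pi / c\<^sup>2 * (r i)\<^sup>2))"
      by (rule ennreal_suminf_cmult[symmetric])
    also have "\<dots> = (\<Sum>i. ennreal (pi / 4) * (ddiam s (C i))\<^sup>2)"
      using \<open>c > 0\<close> r0 by (intro suminf_cong) (simp add: r ennreal_mult[symmetric] ennreal_power)
    finally show ?thesis by (simp add: ennreal_mult[symmetric])
  qed
  then have "ennreal (c\<^sup>2 / 4 * \<bar>det (matrix T)\<bar>) \<le>
    (INF C \<in> {C :: nat \<Rightarrow> (real^2) set. unit_square \<subseteq> (\<Union>i. C i) \<and> (\<forall>i. ddiam s (C i) < ennreal 1)}.
       (\<Sum>i. ennreal (pi / 4) * (ddiam s (C i))\<^sup>2))"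
    by (intro INF_greatest) auto
  also have "\<dots> \<le> hausdorff2 s unit_square"
    unfolding hausdorff2_def by (rule SUP_upper) simp
  finally show ?thesis unfolding s_def .
qed

text \<open>If the seminorm degenerates, \<open>T\<close> has a kernel and its determinant vanishes,
  in agreement with the value 0 of the Jacobian there.\<close>

lemma jacobian_ge:
  fixes T :: "real^2 \<Rightarrow> real^2"
  assumes T: "linear T" and "c > 0"
  shows "ennreal (c\<^sup>2 / 4 * \<bar>det (matrix T)\<bar>) \<le> jacobian (\<lambda>h. c * norm (T h))"
proof (cases "norm2 (\<lambda>h. c * norm (T h))")
  case True
  then show ?thesis using hausdorff2_unit_square_ge[OF assms] by (simp add: jacobian_def)
next
  case False
  have "seminorm2 (\<lambda>h. c * norm (T h))"
    unfolding seminorm2_def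
  proof (intro conjI allI)
    fix x y a
    have "norm (T (x + y)) \<le> norm (T x) + norm (T y)"
      using linear_add[OF T] norm_triangle_ineq by metis
    then show "c * norm (T (x + y)) \<le> c * norm (T x) + c * norm (T y)"
      using \<open>c > 0\<close> by (simp flip: distrib_left)
    show "c * norm (T (a *\<^sub>R x)) = \<bar>a\<bar> * (c * norm (T x))"
      using linear_cmul[OF T, of a x] by simp
  qed
  then obtain x where "T x = 0" "x \<noteq> 0" using False \<open>c > 0\<close> by (auto simp: norm2_def)
  then have "\<not> inj T" using linear_0[OF T] by (metis injD)
  then have "det (matrix T) = 0" using det_nz_iff_inj[OF T] by blast
  then show ?thesis by simp
qed

section \<open>Filling squares\<close>

lemma Basis_vec2: "Basis = {axis 1 1, axis 2 1 :: real^2}"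
proof (intro equalityI subsetI)
  fix b :: "real^2" assume "b \<in> Basis"
  then obtain i where "b = axis i 1" by (auto simp: Basis_vec_def)
  then show "b \<in> {axis 1 1, axis 2 1}" using exhaust_2[of i] by auto
qed (auto simp: Basis_vec_def)

lemma infnorm_vec2: "infnorm x = max \<bar>x $ 1\<bar> \<bar>x $ 2\<bar>" for x :: "real^2"
  unfolding infnorm_Max Basis_vec2 by (simp add: inner_axis)

lemma norm_le_2_infnorm: "norm x \<le> 2 * infnorm x" for x :: "real^2"
proof -
  have "norm x \<le> \<bar>x $ 1\<bar> + \<bar>x $ 2\<bar>" using norm_le_l1_cart[of x] by (simp add: sum_2)
  moreover have "\<bar>x $ 1\<bar> \<le> infnorm x" "\<bar>x $ 2\<bar> \<le> infnorm x" by (simp_all add: infnorm_vec2)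
  ultimately show ?thesis by linarith
qed

text \<open>Radial projection onto the boundary of the square of half-side \<open>a\<close>, the
  sphere of radius \<open>a\<close> in the maximum norm.\<close>

definition square_loop :: "real \<Rightarrow> real^2 \<Rightarrow> real^2" where
  "square_loop a z = (a / infnorm z) *\<^sub>R z"

text \<open>If \<open>q\<close> were missed, the disc could be mapped by \<open>w\<close>, pushed
  from \<open>q\<close> onto the boundary of the square, and normalised to the circle. Normalisation
  undoes \<open>square_loop\<close> on the circle, so this would be a retraction of the disc onto
  its boundary.\<close>

lemma square_covered:
  fixes w :: "real^2 \<Rightarrow> real^2"
  assumes "a > 0" and cont: "continuous_on (cball 0 1) w"
    and bd: "\<And>z. z \<in> sphere 0 1 \<Longrightarrow> w z = square_loop a z"
  shows "{x. infnorm x < a} \<subseteq> w ` cball 0 1"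
proof (rule subsetI, rule ccontr)
  fix q assume q: "q \<in> {x. infnorm x < a}" "q \<notin> w ` cball 0 1"
  define Q where "Q = cbox (vec (-a)) (vec a :: real^2)"
  have int: "interior Q = {x. infnorm x < a}"
    unfolding Q_def interior_cbox by (auto simp: mem_box_cart forall_2 infnorm_vec2 abs_less_iff)
  have Q: "Q = {x. infnorm x \<le> a}"
    unfolding Q_def by (auto simp: mem_box_cart forall_2 infnorm_vec2 abs_le_iff)
  have fr: "frontier Q = {x. infnorm x = a}"
  proof -
    have "closed Q" unfolding Q_def by (rule closed_cbox)
    then show ?thesis unfolding frontier_def closure_closed[OF \<open>closed Q\<close>] int by (auto simp: Q)
  qed
  have "q \<in> rel_interior Q" using q(1) int rel_interior_nonempty_interior[of Q] by auto
  moreover have "affine hull Q = UNIV" using q(1) int by (metis affine_hull_nonempty_interior empty_iff)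
  moreover have "rel_frontier Q = frontier Q" using q(1) int by (metis rel_frontier_nonempty_interior empty_iff)
  ultimately have "{x. infnorm x = a} retract_of (UNIV - {q})"
    using rel_frontier_retract_of_punctured_affine_hull[of Q q] fr by (simp add: Q_def)
  then obtain r where r: "continuous_on (UNIV - {q}) r" "\<And>x. x \<noteq> q \<Longrightarrow> infnorm (r x) = a"
    "\<And>x. infnorm x = a \<Longrightarrow> r x = x"
    unfolding retract_of_def retraction_def by auto
  define \<rho> where "\<rho> z = (1 / norm (r (w z))) *\<^sub>R r (w z)" for z
  have rw: "infnorm (r (w z)) = a" if "z \<in> cball 0 1" for z
  proof (rule r(2))
    show "w z \<noteq> q" using q(2) that by auto
  qed
  then have rw0: "r (w z) \<noteq> 0" if "z \<in> cball 0 1" for z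
    using that \<open>a > 0\<close> by (metis infnorm_0 less_irrefl)
  have "continuous_on (cball 0 1) (\<lambda>z. r (w z))"
    using q(2) by (intro continuous_on_compose2[OF r(1) cont]) auto
  then have "continuous_on (cball 0 1) \<rho>"
    unfolding \<rho>_def using rw0 by (intro continuous_intros) auto
  moreover have "\<rho> z \<in> sphere 0 1" if "z \<in> cball 0 1" for z
    using rw0[OF that] by (simp add: \<rho>_def)
  moreover have "\<rho> z = z" if z: "z \<in> sphere 0 1" for z
  proof -
    have nz: "infnorm z > 0" using z by (auto simp: infnorm_pos_lt)
    have wz: "w z = (a / infnorm z) *\<^sub>R z" using bd[OF z] by (simp add: square_loop_def)
    then have "infnorm (w z) = a" using nz \<open>a > 0\<close> by (simp add: infnorm_mul)
    then have "r (w z) = w z" by (rule r(3))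
    then show ?thesis using wz z nz \<open>a > 0\<close> by (simp add: \<rho>_def)
  qed
  ultimately have "sphere 0 1 retract_of (cball (0 :: real^2) 1)"
    unfolding retract_of_def retraction_def by (intro exI[of _ \<rho>]) auto
  then show False using no_retraction_cball[of 1 "0 :: real^2"] by simp
qed

text \<open>Vertical lines sit at j + 1/2 and horizontal ones at 3 (j + 1/2). The half-sides 3 (m +
  1/2) and their negatives belong to both sets, so all four sides of the square lie on
  lines.\<close>

lemma line_dist_same_coordinate:
  fixes x y :: "real^2" and m :: nat
  defines "a \<equiv> 3 * (real m + 1 / 2)"
  shows "x $ 1 = y $ 1 \<Longrightarrow> \<bar>x $ 1\<bar> = a \<Longrightarrow> line_dist x y \<le> \<bar>x $ 2 - y $ 2\<bar>"
    and "x $ 2 = y $ 2 \<Longrightarrow> \<bar>x $ 2\<bar> = a \<Longrightarrow> line_dist x y \<le> \<bar>x $ 1 - y $ 1\<bar>"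
proof -
  have l1: "dist x y \<le> \<bar>x $ 1 - y $ 1\<bar> + \<bar>x $ 2 - y $ 2\<bar>" for x y :: "real^2"
    using norm_le_l1_cart[of "x - y"] by (simp add: dist_norm sum_2)
  {
    assume eq: "x $ 1 = y $ 1" and "\<bar>x $ 1\<bar> = a"
    then consider "x $ 1 = a" | "x $ 1 = - a" by linarith
    then have "\<exists>j. x $ 1 = of_int j + 1 / 2"
    proof cases
      case 1 then show ?thesis by (intro exI[of _ "3 * int m + 1"]) (simp add: a_def)
    next
      case 2 then show ?thesis by (intro exI[of _ "- 3 * int m - 2"]) (simp add: a_def)
    qed
    then obtain j where "x $ 1 = of_int j + 1 / 2" ..
    then have "x \<in> line 0 j" "y \<in> line 0 j" using eq by (simp_all add: line_def inner_vec2)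
    then show "line_dist x y \<le> \<bar>x $ 2 - y $ 2\<bar>" using line_dist_line l1[of x y] eq by fastforce
  next
    assume eq: "x $ 2 = y $ 2" and "\<bar>x $ 2\<bar> = a"
    then consider "x $ 2 = a" | "x $ 2 = - a" by linarith
    then have "\<exists>j. x $ 2 = (of_int j + 1 / 2) * 3"
    proof cases
      case 1 then show ?thesis by (intro exI[of _ "int m"]) (simp add: a_def)
    next
      case 2 then show ?thesis by (intro exI[of _ "- int m - 1"]) (simp add: a_def)
    qed
    then obtain j where "x $ 2 = (of_int j + 1 / 2) * 3" ..
    then have "x \<in> line (Suc 0) j" "y \<in> line (Suc 0) j" using eq by (simp_all add: line_def inner_vec2)
    then show "line_dist x y \<le> \<bar>x $ 1 - y $ 1\<bar>" using line_dist_line l1[of x y] eq by fastforce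
  }
qed

text \<open>Points on one side or on adjacent sides are joined along the boundary within the
  l1-distance. For opposite sides the connecting side \<open>c\<close> is chosen by the sign of a
  coordinate sum, so that the two detours add up to at most 2a, which is the distance of the sides;
  hence the factor 2.\<close>

lemma line_dist_square_boundary:
  fixes x y :: "real^2" and m :: nat
  defines "a \<equiv> 3 * (real m + 1 / 2)"
  assumes "infnorm x = a" "infnorm y = a"
  shows "line_dist x y \<le> 2 * (\<bar>x $ 1 - y $ 1\<bar> + \<bar>x $ 2 - y $ 2\<bar>)"
proof -
  define pt :: "real \<Rightarrow> real \<Rightarrow> real^2" where "pt s t = vector [s, t]" for s t
  have pt [simp]: "pt s t $ 1 = s" "pt s t $ 2 = t" for s t by (simp_all add: pt_def)
  have pt_id: "pt (x $ 1) (x $ 2) = x" for x by (simp add: vec_eq_iff forall_2)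
  have V: "line_dist (pt c s) (pt c t) \<le> \<bar>s - t\<bar>" if "\<bar>c\<bar> = a" for c s t
    using line_dist_same_coordinate(1)[of "pt c s" "pt c t" m] that by (simp add: a_def)
  have H: "line_dist (pt s c) (pt t c) \<le> \<bar>s - t\<bar>" if "\<bar>c\<bar> = a" for c s t
    using line_dist_same_coordinate(2)[of "pt s c" "pt t c" m] that by (simp add: a_def)
  define x1 x2 y1 y2 where "x1 = x $ 1" "x2 = x $ 2" "y1 = y $ 1" "y2 = y $ 2"
  have xy: "x = pt x1 x2" "y = pt y1 y2" by (simp_all add: x1_x2_y1_y2_def pt_id)
  have a0: "a > 0" by (simp add: a_def)
  have le: "\<bar>x1\<bar> \<le> a" "\<bar>x2\<bar> \<le> a" "\<bar>y1\<bar> \<le> a" "\<bar>y2\<bar> \<le> a"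
    using assms(2,3) by (simp_all add: infnorm_vec2 x1_x2_y1_y2_def)
  note T = line_dist_triangle
  have "line_dist (pt x1 x2) (pt y1 y2) \<le> 2 * (\<bar>x1 - y1\<bar> + \<bar>x2 - y2\<bar>)"
  proof -
    consider "\<bar>x1\<bar> = a" "\<bar>y1\<bar> = a" | "\<bar>x1\<bar> = a" "\<bar>y2\<bar> = a" | "\<bar>x2\<bar> = a" "\<bar>y1\<bar> = a" | "\<bar>x2\<bar> = a" "\<bar>y2\<bar> = a"
      using assms(2,3) unfolding infnorm_vec2 x1_x2_y1_y2_def by linarith
    then show ?thesis
    proof cases
      case 1
      show ?thesis
      proof (cases "x1 = y1")
        case True
        show ?thesis using V[OF 1(1), of x2 y2] unfolding True[symmetric] by (rule order_trans) simp
      next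
        case False
        then have d: "\<bar>x1 - y1\<bar> = 2 * a" using 1 by linarith
        define c where "c = (if x2 + y2 \<ge> 0 then a else - a)"
        have "\<bar>c\<bar> = a" using a0 by (simp add: c_def)
        have "line_dist (pt x1 x2) (pt y1 y2) \<le> \<bar>x2 - c\<bar> + \<bar>x1 - y1\<bar> + \<bar>c - y2\<bar>"
          using T[of "pt x1 x2" "pt y1 y2" "pt x1 c"] T[of "pt x1 c" "pt y1 y2" "pt y1 c"]
            V[of x1 x2 c] H[of c x1 y1] V[of y1 c y2] 1 \<open>\<bar>c\<bar> = a\<close> by linarith
        moreover have "\<bar>x2 - c\<bar> + \<bar>c - y2\<bar> \<le> 2 * a" using le by (auto simp: c_def)
        ultimately show ?thesis using d by (smt (verit))
      qed
    next
      case 2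
      then show ?thesis
        using T[of "pt x1 x2" "pt y1 y2" "pt x1 y2"] V[OF 2(1), of x2 y2] H[OF 2(2), of x1 y1]
        by (smt (verit))
    next
      case 3
      then show ?thesis
        using T[of "pt x1 x2" "pt y1 y2" "pt y1 x2"] H[OF 3(1), of x1 y1] V[OF 3(2), of x2 y2]
        by (smt (verit))
    next
      case 4
      show ?thesis
      proof (cases "x2 = y2")
        case True
        show ?thesis using H[OF 4(1), of x1 y1] unfolding True[symmetric] by (rule order_trans) simp
      next
        case False
        then have d: "\<bar>x2 - y2\<bar> = 2 * a" using 4 by linarith
        define c where "c = (if x1 + y1 \<ge> 0 then a else - a)"
        have "\<bar>c\<bar> = a" using a0 by (simp add: c_def)
        have "line_dist (pt x1 x2) (pt y1 y2) \<le> \<bar>x1 - c\<bar> + \<bar>x2 - y2\<bar> + \<bar>c - y1\<bar>"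
          using T[of "pt x1 x2" "pt y1 y2" "pt c x2"] T[of "pt c x2" "pt y1 y2" "pt c y2"]
            H[of x2 x1 c] V[of c x2 y2] H[of y2 c y1] 4 \<open>\<bar>c\<bar> = a\<close> by linarith
        moreover have "\<bar>x1 - c\<bar> + \<bar>c - y1\<bar> \<le> 2 * a" using le by (auto simp: c_def)
        ultimately show ?thesis using d by (smt (verit))
      qed
    qed
  qed
  then show ?thesis by (simp add: x1_x2_y1_y2_def pt_id)
qed

text \<open>On the unit circle the maximum norm is at least 1/2. The change of \<open>z\<close>
  costs a factor 2a, the change of the scaling another 4a.\<close>

lemma norm_square_loop_diff_le:
  assumes "a > 0" and zw: "norm z = 1" "norm w = 1"
  shows "norm (square_loop a z - square_loop a w) \<le> 6 * a * norm (z - w)"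
proof -
  define s t where "s = infnorm z" "t = infnorm w"
  have st: "1 / 2 \<le> s" "1 / 2 \<le> t"
    using norm_le_2_infnorm[of z] norm_le_2_infnorm[of w] zw by (simp_all add: s_t_def)
  have d: "\<bar>t - s\<bar> \<le> norm (z - w)"
    using absdiff_infnorm[of w z] infnorm_le_norm[of "w - z"] by (simp add: s_t_def norm_minus_commute)
  have "1 / s \<le> 2" "1 / t \<le> 2" using st by (simp_all add: field_simps)
  have "norm (square_loop a z - square_loop a w) = norm ((a / s) *\<^sub>R (z - w) + (a / s - a / t) *\<^sub>R w)"
    by (simp add: square_loop_def s_t_def scaleR_right_diff_distrib scaleR_left_diff_distrib)
  also have "\<dots> \<le> a / s * norm (z - w) + \<bar>a / s - a / t\<bar>"
    using norm_triangle_ineq[of "(a / s) *\<^sub>R (z - w)" "(a / s - a / t) *\<^sub>R w"] st zw \<open>a > 0\<close> by simp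
  also have "a / s - a / t = a * (t - s) * (1 / s) * (1 / t)"
    using st by (simp add: field_simps)
  also have "\<bar>a * (t - s) * (1 / s) * (1 / t)\<bar> = a * \<bar>t - s\<bar> * (1 / s) * (1 / t)"
    using st \<open>a > 0\<close> by (simp add: abs_mult)
  also have "\<dots> \<le> a * norm (z - w) * 2 * 2"
    using st d \<open>1 / s \<le> 2\<close> \<open>1 / t \<le> 2\<close> \<open>a > 0\<close> by (intro mult_mono) auto
  also have "a / s * norm (z - w) \<le> a * 2 * norm (z - w)"
  proof -
    have "a * (1 / s) \<le> a * 2" using \<open>1 / s \<le> 2\<close> \<open>a > 0\<close> by (intro mult_left_mono) auto
    then show ?thesis by (intro mult_right_mono) auto
  qed
  finally show ?thesis by (simp add: algebra_simps)
qed

text \<open>The factor 24 is 4 times 6: the l1-norm is at most twice the Euclidean one, the boundary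
  of the square doubles it again, and \<open>square_loop\<close> itself contributes 6a.\<close>

lemma line_dist_square_loop:
  fixes m :: nat
  defines "a \<equiv> 3 * (real m + 1 / 2)"
  assumes zw: "norm z = 1" "norm w = 1"
  shows "line_dist (square_loop a z) (square_loop a w) \<le> 24 * a * dist z w"
proof -
  have "a > 0" by (simp add: a_def)
  have inf: "infnorm (square_loop a z) = a" if "norm z = 1" for z
  proof -
    have "infnorm z > 0" using that by (auto simp: infnorm_pos_lt)
    then show ?thesis using \<open>a > 0\<close> by (simp add: square_loop_def infnorm_mul)
  qed
  define D where "D = square_loop a z - square_loop a w"
  have "line_dist (square_loop a z) (square_loop a w) \<le> 2 * (\<bar>D $ 1\<bar> + \<bar>D $ 2\<bar>)"
    using line_dist_square_boundary[of "square_loop a z" m "square_loop a w"] inf zw by (simp add: a_def D_def)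
  also have "\<dots> \<le> 4 * norm D"
    using component_le_norm_cart[of D 1] component_le_norm_cart[of D 2] by simp
  also have "\<dots> \<le> 4 * (6 * a * norm (z - w))"
    using norm_square_loop_diff_le[OF \<open>a > 0\<close> zw] by (simp add: D_def)
  finally show ?thesis by (simp add: dist_norm)
qed

section \<open>Length of the square loop and area of its fillings\<close>

lemma curve_length_le:
  assumes "\<And>s t. d (\<gamma> s) (\<gamma> t) \<le> K * \<bar>s - t\<bar>" "K \<ge> 0"
  shows "curve_length d \<gamma> a b \<le> ennreal (K * (b - a))"
  unfolding curve_length_def
proof (rule SUP_least, clarify)
  fix k and t :: "nat \<Rightarrow> real"
  assume t: "a = t 0" "b = t k" "\<forall>i<k. t i \<le> t (Suc i)"
  have "(\<Sum>i<k. ennreal (d (\<gamma> (t i)) (\<gamma> (t (Suc i))))) \<le> (\<Sum>i<k. ennreal (K * (t (Suc i) - t i)))"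
  proof (intro sum_mono ennreal_leI)
    fix i assume "i \<in> {..<k}"
    then have "\<bar>t i - t (Suc i)\<bar> = t (Suc i) - t i" using t(3) by simp
    then show "d (\<gamma> (t i)) (\<gamma> (t (Suc i))) \<le> K * (t (Suc i) - t i)"
      using assms(1)[of "t i" "t (Suc i)"] by simp
  qed
  also have "\<dots> = ennreal (\<Sum>i<k. K * (t (Suc i) - t i))"
    using t(3) assms(2) by (intro sum_ennreal) auto
  also have "(\<Sum>i<k. K * (t (Suc i) - t i)) = K * (t k - t 0)"
    by (simp add: sum_distrib_left[symmetric] sum_lessThan_telescope)
  finally show "(\<Sum>i<k. ennreal (d (\<gamma> (t i)) (\<gamma> (t (Suc i))))) \<le> ennreal (K * (t k - t 0))" .
qed

text \<open>Lipschitz constant times parameter length gives 24 a times 2 pi, and pi \<le> 10/3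
  rounds this to 160a.\<close>

lemma loop_length_square_loop:
  fixes m :: nat
  defines "a \<equiv> 3 * (real m + 1 / 2)"
  shows "loop_length line_dist (square_loop a) \<le> ennreal (160 * a)"
proof -
  have "a > 0" by (simp add: a_def)
  have "line_dist (square_loop a (circ s)) (square_loop a (circ t)) \<le> 24 * a * \<bar>s - t\<bar>" for s t
  proof -
    have "line_dist (square_loop a (circ s)) (square_loop a (circ t)) \<le> 24 * a * dist (circ s) (circ t)"
      unfolding a_def by (rule line_dist_square_loop) simp_all
    also have "\<dots> \<le> 24 * a * \<bar>s - t\<bar>"
      using dist_circ_le \<open>a > 0\<close> by (intro mult_left_mono) auto
    finally show ?thesis .
  qed
  then have "loop_length line_dist (square_loop a) \<le> ennreal (24 * a * (2 * pi - 0))"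
    unfolding loop_length_def using \<open>a > 0\<close> by (intro curve_length_le) auto
  also have "\<dots> \<le> ennreal (160 * a)"
  proof (rule ennreal_leI)
    have "pi \<le> 10 / 3" using pi_approx by simp
    then have "a * pi \<le> a * (10 / 3)" using \<open>a > 0\<close> by (intro mult_left_mono) auto
    then show "24 * a * (2 * pi - 0) \<le> 160 * a" by (simp add: algebra_simps)
  qed
  finally show ?thesis .
qed

text \<open>On the good points the Jacobian of the metric derivative is at least \<Lambda>^2/4 times
  |det|. The integral of |det| bounds the measure of the image, injective or not, and the image
  contains the square of area 4 a^2 up to a null set.\<close>

lemma fill_area_square_loop:
  assumes "a > 0"
  shows "ennreal (\<Lambda>\<^sup>2 * a\<^sup>2) \<le> fill_area_lip line_dist (square_loop a)"
  unfolding fill_area_lip_def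
proof (rule INF_greatest)
  fix v assume "v \<in> {v. d_lipschitz_on line_dist (cball 0 1) v \<and> (\<forall>z\<in>sphere 0 1. v z = square_loop a z)}"
  then have Lv: "d_lipschitz_on line_dist (cball 0 1) v"
    and bd: "\<And>z. z \<in> sphere 0 1 \<Longrightarrow> v z = square_loop a z" by auto
  obtain L0 where L0: "\<And>z z'. z \<in> cball 0 1 \<Longrightarrow> z' \<in> cball 0 1 \<Longrightarrow> line_dist (v z) (v z') \<le> L0 * dist z z'"
    using Lv unfolding d_lipschitz_on_def by blast
  define L where "L = max L0 0"
  have L: "dist (v z) (v z') \<le> L * dist z z'" if "z \<in> cball 0 1" "z' \<in> cball 0 1" for z z'
  proof -
    have "L0 * dist z z' \<le> L * dist z z'" by (rule mult_right_mono) (simp_all add: L_def)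
    then show ?thesis using L0[OF that] dist_le_line_dist[of "v z" "v z'"] by linarith
  qed
  \<comment> \<open>The nearest-point projection to the disc is 1-Lipschitz, so this extends
    \<open>v\<close> to a Lipschitz map of the whole plane, as Rademacher's theorem
    requires.\<close>
  define w where "w z = v (closest_point (cball 0 1) z)" for z
  have cp: "closest_point (cball 0 1) z \<in> cball 0 1" for z :: "real^2"
    by (rule closest_point_in_set) auto
  have wv: "w z = v z" if "z \<in> cball 0 1" for z
    unfolding w_def using that by (simp only: closest_point_self)
  have w_Lip: "dist (w x) (w y) \<le> L * dist x y" for x y
  proof -
    have "dist (w x) (w y) \<le> L * dist (closest_point (cball 0 1) x) (closest_point (cball 0 1) y)"
      unfolding w_def by (rule L[OF cp cp])
    also have "\<dots> \<le> L * dist x y"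
      by (intro mult_left_mono closest_point_lipschitz) (auto simp: L_def)
    finally show ?thesis .
  qed
  have w_cont: "continuous_on A w" for A
    by (rule lipschitz_on_continuous_on[of L], rule lipschitz_onI) (use w_Lip in \<open>auto simp: L_def\<close>)
  define N where "N = {z. \<not> w differentiable (at z)}"
  have N: "negligible N" unfolding N_def by (rule Rademacher_vec2[OF w_Lip])
  \<comment> \<open>The points mapped into \<open>lines\<close> may have positive measure in the
    disc; they are dropped here because their image is null.\<close>
  define S where "S = (ball 0 1 \<inter> w -` (- lines)) - N"
  have "w -` (- lines) \<in> sets borel"
    by (rule measurable_sets_borel[OF borel_measurable_continuous_onI[OF w_cont] borel_comp[OF borel_lines]])
  then have S: "S \<in> sets lebesgue"
    unfolding S_def using negligible_imp_sets[OF N] by (intro sets.Diff sets.Int) auto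
  define w' where "w' z = frechet_derivative w (at z)" for z
  have w': "(w has_derivative w' z) (at z)" if "z \<in> S" for z
    using that frechet_derivative_works[of w "at z"] by (simp add: S_def N_def w'_def)
  define J where "J z = \<bar>det (matrix (w' z))\<bar>" for z
  have J_le: "ennreal (\<Lambda>\<^sup>2 / 4 * J z) \<le> jacobian (md line_dist v z)" if z: "z \<in> S" for z
  proof -
    have "z \<in> ball 0 1" using z by (simp add: S_def)
    have v': "(v has_derivative w' z) (at z)"
      by (rule has_derivative_transform_within_open[OF w'[OF z] open_ball \<open>z \<in> ball 0 1\<close>]) (simp add: wv)
    have "v z \<notin> lines" using z wv[of z] by (simp add: S_def)
    with v' have "md line_dist v z = (\<lambda>h. \<Lambda> * norm (w' z h))" by (rule md_line_dist)
    moreover have "linear (w' z)" using w'[OF z] has_derivative_linear by blast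
    ultimately show ?thesis using jacobian_ge[of "w' z" \<Lambda>] by (simp add: J_def \<Lambda>_def)
  qed
  have J_meas: "J \<in> borel_measurable (lebesgue_on S)"
    unfolding J_def
    by (intro borel_measurable_abs borel_measurable_det_Jacobian[OF S, of w])
      (rule has_derivative_at_withinI[OF w'])
  define X where "X = (\<integral>\<^sup>+z. ennreal (J z) \<partial>lebesgue_on S)"
  have area_ge: "ennreal (\<Lambda>\<^sup>2 / 4) * X \<le> area line_dist v"
  proof -
    have "ennreal (\<Lambda>\<^sup>2 / 4) * X = (\<integral>\<^sup>+z. ennreal (\<Lambda>\<^sup>2 / 4) * ennreal (J z) \<partial>lebesgue_on S)"
      unfolding X_def using J_meas by (intro nn_integral_cmult[symmetric]) simp
    also have "\<dots> = (\<integral>\<^sup>+z. (ennreal (\<Lambda>\<^sup>2 / 4) * ennreal (J z)) * indicator S z \<partial>lebesgue)"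
      using S by (intro nn_integral_restrict_space) simp
    also have "\<dots> \<le> (\<integral>\<^sup>+z. jacobian (md line_dist v z) * indicator (ball 0 1) z \<partial>lebesgue)"
    proof (rule nn_integral_mono)
      fix z
      show "ennreal (\<Lambda>\<^sup>2 / 4) * ennreal (J z) * indicator S z \<le> jacobian (md line_dist v z) * indicator (ball 0 1) z"
      proof (cases "z \<in> S")
        case True
        then have "z \<in> ball 0 1" by (simp add: S_def)
        have "J z \<ge> 0" by (simp add: J_def)
        then have "ennreal (\<Lambda>\<^sup>2 / 4) * ennreal (J z) = ennreal (\<Lambda>\<^sup>2 / 4 * J z)"
          by (intro ennreal_mult[symmetric]) (simp_all add: \<Lambda>_def)
        then show ?thesis using J_le[OF True] True \<open>z \<in> ball 0 1\<close> by (simp only: indicator_simps mult_1_right)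
      qed simp
    qed
    also have "\<dots> = area line_dist v" unfolding area_def ..
    finally show ?thesis .
  qed
  show "ennreal (\<Lambda>\<^sup>2 * a\<^sup>2) \<le> area line_dist v"
  \<comment> \<open>The image estimate asks for an integrable determinant. If its integral is
    infinite, so is the area, and the bound is immediate.\<close>
  proof (cases "X = \<infinity>")
    case True
    then show ?thesis using area_ge by (simp add: ennreal_mult_top \<Lambda>_def top_unique)
  next
    case False
    have J_int: "integrable (lebesgue_on S) J"
      using J_meas False by (intro integrableI_nonneg) (auto simp: X_def J_def less_top)
    have J_on: "J integrable_on S" using integrable_on_lebesgue_on[OF J_int S] .
    have wS: "w ` S \<in> lmeasurable" "measure lebesgue (w ` S) \<le> integral S J"
      using measurable_differentiable_image[OF S has_derivative_at_withinI[OF w']]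
        measure_differentiable_image[OF S has_derivative_at_withinI[OF w']] J_on
      unfolding J_def by simp_all
    have "X = ennreal (integral\<^sup>L (lebesgue_on S) J)"
      unfolding X_def by (rule nn_integral_eq_integral[OF J_int]) (simp add: J_def)
    also have "integral\<^sup>L (lebesgue_on S) J = integral S J"
      by (rule lebesgue_integral_eq_integral[OF J_int S])
    finally have X: "X = ennreal (integral S J)" .
    \<comment> \<open>The image of everything in the closed disc outside \<open>S\<close>: the first
      two sets are Lipschitz images of null sets, the third absorbs the discarded preimage of the
      lines.\<close>
    define Z where "Z = w ` N \<union> w ` sphere 0 1 \<union> lines"
    have Z: "negligible Z"
      unfolding Z_def
      by (intro negligible_Un negligible_lines negligible_Lipschitz_image[OF _ _ w_Lip] N negligible_sphere) auto
    have "{x. infnorm x < a} \<subseteq> w ` cball 0 1"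
      using bd wv by (intro square_covered[OF \<open>a > 0\<close> w_cont]) simp
    also have "w ` cball 0 1 \<subseteq> w ` S \<union> Z"
    proof
      fix y assume "y \<in> w ` cball 0 1"
      then obtain z where z: "y = w z" "z \<in> cball 0 1" by blast
      show "y \<in> w ` S \<union> Z"
      proof (cases "z \<in> S")
        case False
        then have "z \<notin> ball 0 1 \<or> w z \<in> lines \<or> z \<in> N" by (auto simp: S_def)
        moreover have "z \<in> sphere 0 1" if "z \<notin> ball 0 1" using z(2) that by simp
        ultimately show ?thesis using z(1) unfolding Z_def by blast
      qed (use z in blast)
    qed
    finally have sub: "{x. infnorm x < a} \<subseteq> w ` S \<union> Z" .
    have box: "{x. infnorm x < a} = box (vec (-a)) (vec a :: real^2)"
      by (auto simp: mem_box_cart forall_2 infnorm_vec2 abs_less_iff)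
    have "4 * a\<^sup>2 = measure lebesgue (box (vec (-a)) (vec a :: real^2))"
    proof -
      have "measure lborel (box (vec (-a)) (vec a :: real^2)) = (\<Prod>b\<in>Basis. (vec a - vec (-a) :: real^2) \<bullet> b)"
        using \<open>a > 0\<close> by (intro measure_lborel_box) (auto simp: Basis_vec2 inner_axis)
      also have "\<dots> = 4 * a\<^sup>2"
        unfolding Basis_vec2 by (simp add: axis_eq_axis inner_axis power2_eq_square)
      finally show ?thesis by simp
    qed
    also have "\<dots> \<le> measure lebesgue (w ` S \<union> Z)"
      using sub wS(1) Z unfolding box
      by (intro measure_mono_fmeasurable) (auto intro: fmeasurable.Un negligible_imp_measurable)
    also have "\<dots> \<le> measure lebesgue (w ` S) + measure lebesgue Z"
      using wS(1) Z by (intro measure_Un_le) (auto intro: negligible_imp_sets fmeasurableD)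
    also have "measure lebesgue Z = 0" using Z by (rule negligible_imp_measure0)
    finally have "4 * a\<^sup>2 \<le> integral S J" using wS(2) by simp
    moreover from this have "0 \<le> integral S J" using zero_le_power2[of a] by linarith
    ultimately have "ennreal (\<Lambda>\<^sup>2 / 4 * (4 * a\<^sup>2)) \<le> ennreal (\<Lambda>\<^sup>2 / 4) * X"
      unfolding X by (subst ennreal_mult[symmetric]) (auto intro!: ennreal_leI mult_left_mono simp: \<Lambda>_def)
    then show ?thesis using area_ge by (simp add: order_trans)
  qed
qed

lemma square_loop_lipschitz:
  fixes m :: nat
  defines "a \<equiv> 3 * (real m + 1 / 2)"
  shows "d_lipschitz_on line_dist (sphere 0 1) (square_loop a)"
  unfolding d_lipschitz_on_def a_def
  by (intro exI[of _ "24 * (3 * (real m + 1 / 2))"] ballI line_dist_square_loop) auto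

text \<open>The largest admissible half-side with 160 a \<le> r is used. Consecutive half-sides
  differ by 3, so a > r/160 - 3, and this is at least r/320 exactly when r \<ge> 960. Then
  \<Lambda>^2 a^2 \<ge> (1000/320)^2 r^2 \<ge> 9 r^2.\<close>

lemma dehn_lip_line_dist_ge:
  assumes "r \<ge> 960"
  shows "ennreal (9 * r\<^sup>2) \<le> dehn_lip line_dist r"
proof -
  define m where "m = nat \<lfloor>(r / 160 - 3 / 2) / 3\<rfloor>"
  define a where "a = 3 * (real m + 1 / 2)"
  have "0 \<le> (r / 160 - 3 / 2) / 3" using assms by simp
  then have m: "real m \<le> (r / 160 - 3 / 2) / 3" "(r / 160 - 3 / 2) / 3 < real m + 1"
    unfolding m_def by linarith+
  have a: "160 * a \<le> r" "r / 320 \<le> a" using m assms unfolding a_def by (simp_all add: field_simps)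
  have "9 * r\<^sup>2 \<le> \<Lambda>\<^sup>2 * a\<^sup>2"
  proof -
    have "(r / 320)\<^sup>2 \<le> a\<^sup>2" using a(2) assms by (intro power_mono) auto
    then have "r\<^sup>2 \<le> 102400 * a\<^sup>2" by (simp add: power_divide)
    moreover have "0 \<le> a\<^sup>2" by simp
    moreover have \<Lambda>2: "\<Lambda>\<^sup>2 = 1000000" by (simp add: \<Lambda>_def)
    ultimately show ?thesis unfolding \<Lambda>2 by linarith
  qed
  then have "ennreal (9 * r\<^sup>2) \<le> ennreal (\<Lambda>\<^sup>2 * a\<^sup>2)" by (rule ennreal_leI)
  also have "\<dots> \<le> fill_area_lip line_dist (square_loop a)"
    by (rule fill_area_square_loop) (simp add: a_def)
  also have "\<dots> \<le> dehn_lip line_dist r"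
    unfolding dehn_lip_def
  proof (rule SUP_upper, intro CollectI conjI)
    show "d_lipschitz_on line_dist (sphere 0 1) (square_loop a)"
      unfolding a_def by (rule square_loop_lipschitz)
    have "loop_length line_dist (square_loop a) \<le> ennreal (160 * a)"
      unfolding a_def by (rule loop_length_square_loop)
    also have "\<dots> \<le> ennreal r" using a(1) by (rule ennreal_leI)
    finally show "loop_length line_dist (square_loop a) \<le> ennreal r" .
  qed
  finally show ?thesis .
qed

lemma Liminf_dehn_lip_line_dist:
  "ennreal (1 / (4 * pi)) < Liminf at_top (\<lambda>r. dehn_lip line_dist r / ennreal (r\<^sup>2))"
proof -
  have "1 / (4 * pi) < 9" using pi_gt3 by (simp add: divide_simps)
  then have "ennreal (1 / (4 * pi)) < ennreal 9" by (simp add: ennreal_less_iff)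
  also have "ennreal 9 \<le> Liminf at_top (\<lambda>r. dehn_lip line_dist r / ennreal (r\<^sup>2))"
  proof (rule Liminf_bounded)
    show "\<forall>\<^sub>F r in at_top. ennreal 9 \<le> dehn_lip line_dist r / ennreal (r\<^sup>2)"
      using eventually_ge_at_top[of 960]
    proof eventually_elim
      case (elim r)
      have "ennreal 9 = ennreal (9 * r\<^sup>2) / ennreal (r\<^sup>2)"
        using elim by (subst divide_ennreal) auto
      also have "\<dots> \<le> dehn_lip line_dist r / ennreal (r\<^sup>2)"
        by (rule divide_right_mono_ennreal[OF dehn_lip_line_dist_ge[OF elim]])
      finally show ?case .
    qed
  qed
  finally show ?thesis .
qed

theorem theorem1p2:
  shows "\<exists>d :: real^2 \<Rightarrow> real^2 \<Rightarrow> real.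
    is_metric d \<and> complete_metric d \<and> geodesic_metric d \<and> bilipschitz_to_R2 d \<and>
    Liminf at_top (\<lambda>r::real. dehn_lip d r / ennreal (r\<^sup>2)) > ennreal (1 / (4 * pi)) \<and>
    all_asymptotic_cones_euclidean_plane d"
  using is_metric_line_dist complete_metric_line_dist geodesic_metric_line_dist
    bilipschitz_to_R2_line_dist Liminf_dehn_lip_line_dist asymptotic_cones_line_dist
  by (intro exI[of _ line_dist] conjI)

end
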